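(* Let $\mathbb{\Lambda}=\{\pm\lambda^n:n\in\mathbb{Z}\}$ where $\lambda$ is one of: (i) $\lambda=2$; (ii) $\lambda=\sigma$, the plastic number; (iii) $\lambda>1$ satisfying $1=\lambda^b-\lambda^a$ for mutually prime integers $0\le a<b\le 62$ with $(a,b)\notin\{(1,3),(4,5)\}$. In cases (i) and (iii), the binary operations $\ast$ on $\mathcal{A}$ satisfying properties (P.1)–(P.5), (S.1), (S.2) are exactly the operations $$(f\ast g)(k)=c\sum_{\substack{(p,q)\in\mathbb{\Lambda}\times\mathbb{\Lambda}\\ p+q=1}} f(pk)\,g(qk),\qquad k\in\mathbb{\Lambda},$$ with $c\in\mathbb{R}$ (so the product is unique up to a real prefactor). In case (ii), they are exactly the operations $$(f\ast g)(k)=c_1\sum_{(p,q)\in T_1} f(pk)g(qk)+c_2\sum_{(p,q)\in T_2} f(pk)g(qk),\qquad k\in\mathbb{\Lambda},$$ with arbitrary $c_1,c_2\in\mathbb{R}$, where $T_1=\{(\sigma^3,-\sigma),(-\sigma,\sigma^3),(\sigma^2,-\sigma^{-1}),(-\sigma^{-1},\sigma^2),(\sigma^{-3},\sigma^{-2}),(\sigma^{-2},\sigma^{-3})\}$ and $T_2=\{(\sigma^5,-\sigma^4),(-\sigma^4,\sigma^5),(\sigma,-\sigma^{-4}),(-\sigma^{-4},\sigma),(\sigma^{-5},\sigma^{-1}),(\sigma^{-1},\sigma^{-5})\}$.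
   Context: The plastic number $\sigma\approx1.325$ is the unique real root of $x^3-x-1=0$. Let $\mathcal{A}$ be the set of functions $f:\mathbb{\Lambda}\to\mathbb{C}$ that are absolutely summable ($\sum_{k}|f(k)|<\infty$) and satisfy the reality condition $f(-k)=\overline{f(k)}$. Define the derivative $(\partial f)(k)=ik\,f(k)$, the inner product $(f,g)=\sum_{k\in\mathbb{\Lambda}} f(k)\overline{g(k)}$, and the rescaling $(\delta_\lambda f)(k)=f(\lambda k)$. A product on $\mathbb{\Lambda}$ is a binary operation $\ast$ on $\mathcal{A}$ with: (P.1) reality: $(f\ast g)(-k)=\overline{(f\ast g)(k)}$; (P.2) bilinearity over $\mathbb{R}$: $(f+\gamma g)\ast h=f\ast h+\gamma(g\ast h)$ for $\gamma\in\mathbb{R}$; (P.3) commutativity $f\ast g=g\ast f$; (P.4) associativity in average $(f\ast g,h)=(f,g\ast h)$; (P.5) Leibniz rule $\partial(f\ast g)=\partial f\ast g+f\ast\partial g$. Symmetries: (S.1) scaling invariance $\delta_\lambda(f\ast g)=\delta_\lambda f\ast\delta_\lambda g$; (S.2) parity: $(f\ast g)\circ R=(f\circ R)\ast(g\circ R)$ for $R(k)=-k$ (the one-dimensional case of the cube symmetry group). *)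

theory Defs
  imports "HOL-Analysis.Analysis"
begin

definition lattice :: "real \<Rightarrow> real set" where
  "lattice lam = {x. \<exists>n::int. x = lam powi n \<or> x = - (lam powi n)}"

text \<open>Functions Lambda -> C are represented as functions real -> complex
  vanishing outside Lambda. The space A: absolutely summable, reality condition.\<close>
definition algA :: "real \<Rightarrow> (real \<Rightarrow> complex) set" where
  "algA lam = {f. (\<forall>k. k \<notin> lattice lam \<longrightarrow> f k = 0)
                 \<and> (\<lambda>k. norm (f k)) summable_on (lattice lam)
                 \<and> (\<forall>k. f (- k) = cnj (f k))}"

definition dlat :: "(real \<Rightarrow> complex) \<Rightarrow> (real \<Rightarrow> complex)" where
  "dlat f = (\<lambda>k. \<i> * complex_of_real k * f k)"

definition dil :: "real \<Rightarrow> (real \<Rightarrow> complex) \<Rightarrow> (real \<Rightarrow> complex)" where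
  "dil lam f = (\<lambda>k. f (lam * k))"

definition ip :: "real \<Rightarrow> (real \<Rightarrow> complex) \<Rightarrow> (real \<Rightarrow> complex) \<Rightarrow> complex" where
  "ip lam f g = (\<Sum>\<^sub>\<infinity>k\<in>lattice lam. f k * cnj (g k))"

definition symmetric_product ::
  "real \<Rightarrow> ((real \<Rightarrow> complex) \<Rightarrow> (real \<Rightarrow> complex) \<Rightarrow> (real \<Rightarrow> complex)) \<Rightarrow> bool" where
  "symmetric_product lam op \<longleftrightarrow>
     (\<forall>f\<in>algA lam. \<forall>g\<in>algA lam. op f g \<in> algA lam)
   \<and> (\<forall>f\<in>algA lam. \<forall>g\<in>algA lam. \<forall>k. op f g (- k) = cnj (op f g k))
   \<and> (\<forall>f\<in>algA lam. \<forall>g\<in>algA lam. \<forall>h\<in>algA lam. \<forall>\<gamma>::real.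
         op (\<lambda>k. f k + complex_of_real \<gamma> * g k) h = (\<lambda>k. op f h k + complex_of_real \<gamma> * op g h k))
   \<and> (\<forall>f\<in>algA lam. \<forall>g\<in>algA lam. op f g = op g f)
   \<and> (\<forall>f\<in>algA lam. \<forall>g\<in>algA lam. \<forall>h\<in>algA lam. ip lam (op f g) h = ip lam f (op g h))
   \<and> (\<forall>f\<in>algA lam. \<forall>g\<in>algA lam. dlat f \<in> algA lam \<longrightarrow> dlat g \<in> algA lam \<longrightarrow>
         dlat (op f g) = (\<lambda>k. op (dlat f) g k + op f (dlat g) k))
   \<and> (\<forall>f\<in>algA lam. \<forall>g\<in>algA lam. dil lam (op f g) = op (dil lam f) (dil lam g))
   \<and> (\<forall>f\<in>algA lam. \<forall>g\<in>algA lam. op f g \<circ> uminus = op (f \<circ> uminus) (g \<circ> uminus))"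

definition triad_sum :: "real \<Rightarrow> (real \<Rightarrow> complex) \<Rightarrow> (real \<Rightarrow> complex) \<Rightarrow> real \<Rightarrow> complex" where
  "triad_sum lam f g k =
     (\<Sum>\<^sub>\<infinity>(p, q)\<in>{(p, q). p \<in> lattice lam \<and> q \<in> lattice lam \<and> p + q = 1}. f (p * k) * g (q * k))"

definition T1 :: "real \<Rightarrow> (real \<times> real) set" where
  "T1 s = {(s powi 3, - s), (- s, s powi 3), (s powi 2, - (s powi (-1))), (- (s powi (-1)), s powi 2),
           (s powi (-3), s powi (-2)), (s powi (-2), s powi (-3))}"

definition T2 :: "real \<Rightarrow> (real \<times> real) set" where
  "T2 s = {(s powi 5, - (s powi 4)), (- (s powi 4), s powi 5), (s, - (s powi (-4))), (- (s powi (-4)), s),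
           (s powi (-5), s powi (-1)), (s powi (-1), s powi (-5))}"

end

theory Submission
  imports Defs "HOL-Computational_Algebra.Polynomial"
begin

text \<open>
  On single Fourier modes the Leibniz rule forces the wave numbers of the two factors to add up
  to that of the product, so with scaling a product is determined by one coefficient per pair
  \<open>(p, q)\<close> with \<open>p + q = 1\<close>. Parity and reality make the coefficients real; commutativity,
  averaged associativity and scaling make them invariant under \<open>(p, q) \<mapsto> (q, p)\<close> and
  \<open>(p, q) \<mapsto> (1/p, -q/p)\<close>. Hence the dimension of the space of products is the number of orbits of
  solutions of \<open>p + q = 1\<close>, and every orbit contains some \<open>(\<lambda>^m, -\<lambda>^n)\<close> with \<open>0 \<le> n < m\<close>.

  To count the orbits, let \<open>P = x^b - x^a - 1\<close> and \<open>Q = x^m - x^n - 1\<close> share the root \<open>\<lambda> > 1\<close>, and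
  let \<open>F\<close> be a common integer factor with root \<open>\<lambda>\<close>. Write \<open>P = F G\<close>, and \<open>*\<close> for the reciprocal
  polynomial. Then \<open>H = F G*\<close> satisfies \<open>H H* = P P*\<close>, so the squares of its coefficients sum to 3,
  and it follows that \<open>H\<close> is \<open>\<plusminus>P\<close> or \<open>\<plusminus>P*\<close> (Ljunggren's argument). Since \<open>P\<close> does not vanish at
  \<open>1/\<lambda>\<close>, \<open>F\<close> is not self-reciprocal, whence \<open>G* = \<plusminus>G\<close>. The same holds for \<open>Q\<close>, so
  \<open>P Q* = P* Q\<close>, and for coprime \<open>a, b\<close> comparing exponents leaves only \<open>(m, n) = (b, a)\<close> and the
  plastic coincidence of \<open>(3, 1)\<close> with \<open>(5, 4)\<close>.
\<close>

section \<open>Trinomials with a common root\<close>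

text \<open>The sign \<open>s\<close> is a parameter because the reciprocal of
  \<open>x^b - x^a - 1\<close> is, up to sign, \<open>x^b + x^(b-a) - 1\<close>, a trinomial of the
  other sign.\<close>

definition trinom :: "int \<Rightarrow> nat \<Rightarrow> nat \<Rightarrow> int poly" where
  "trinom s a b = monom 1 b + monom s a - 1"

definition int_poly_eval :: "int poly \<Rightarrow> real \<Rightarrow> real" where
  "int_poly_eval p x = poly (map_poly real_of_int p) x"

section \<open>Values of integer polynomials at real points\<close>

lemma int_poly_eval_altdef: "int_poly_eval p x = (\<Sum>i\<le>degree p. of_int (coeff p i) * x ^ i)"
  by (simp add: int_poly_eval_def poly_altdef coeff_map_poly degree_map_poly)

lemma int_poly_eval_pCons: "int_poly_eval (pCons c p) x = of_int c + x * int_poly_eval p x"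
  by (simp add: int_poly_eval_def map_poly_pCons)

lemma int_poly_eval_0 [simp]: "int_poly_eval 0 x = 0"
  by (simp add: int_poly_eval_def)

lemma int_poly_eval_add: "int_poly_eval (p + q) x = int_poly_eval p x + int_poly_eval q x"
proof -
  have "map_poly real_of_int (p + q) = map_poly real_of_int p + map_poly real_of_int q"
    by (rule poly_eqI) (simp add: coeff_map_poly)
  then show ?thesis by (simp add: int_poly_eval_def)
qed

lemma int_poly_eval_smult: "int_poly_eval (smult c p) x = of_int c * int_poly_eval p x"
  by (simp add: int_poly_eval_def map_poly_smult)

lemma int_poly_eval_mult: "int_poly_eval (p * q) x = int_poly_eval p x * int_poly_eval q x"
  by (induction p)
     (simp_all add: int_poly_eval_add int_poly_eval_smult int_poly_eval_pCons algebra_simps)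

lemma int_poly_eval_monom: "int_poly_eval (monom c n) x = of_int c * x ^ n"
  by (simp add: int_poly_eval_def map_poly_monom poly_monom)

lemma int_poly_eval_diff: "int_poly_eval (p - q) x = int_poly_eval p x - int_poly_eval q x"
  using int_poly_eval_add[of "p - q" q x] by simp

lemma int_poly_eval_1 [simp]: "int_poly_eval 1 x = 1"
  by (simp add: int_poly_eval_def)

lemma int_poly_eval_trinom: "int_poly_eval (trinom s a b) x = x ^ b + of_int s * x ^ a - 1"
  by (simp add: trinom_def int_poly_eval_diff int_poly_eval_add int_poly_eval_monom)

lemma int_poly_eval_reflect:
  assumes "x \<noteq> 0"
  shows "int_poly_eval (reflect_poly p) x = x ^ degree p * int_poly_eval p (1 / x)"
proof -
  have "map_poly real_of_int (reflect_poly p) = reflect_poly (map_poly real_of_int p)"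
    by (rule poly_eqI) (simp add: coeff_map_poly coeff_reflect_poly degree_map_poly)
  then show ?thesis
    using assms by (simp add: int_poly_eval_def poly_reflect_poly_nz degree_map_poly inverse_eq_divide)
qed

text \<open>A nonzero integer polynomial of least degree vanishing at \<open>x\<close> plays the
  role of the minimal polynomial; its primitive part divides every nonzero integer polynomial with
  root \<open>x\<close>, by pseudo-division and Gauss's lemma.\<close>

lemma common_root_imp_common_factor:
  assumes "p \<noteq> 0" "int_poly_eval p x = 0" "q \<noteq> 0" "int_poly_eval q x = 0"
  obtains f where "f dvd p" "f dvd q" "int_poly_eval f x = 0"
proof -
  define Z where "Z = (\<lambda>r. r \<noteq> 0 \<and> int_poly_eval r x = 0)"
  obtain g where g: "Z g" "\<And>r. Z r \<Longrightarrow> degree g \<le> degree r"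
    using ex_has_least_nat[of Z p degree] assms by (auto simp: Z_def)
  define f where "f = primitive_part g"
  have g0: "g \<noteq> 0" using g by (simp add: Z_def)
  have f0: "f \<noteq> 0" using g0 by (simp add: f_def)
  have "int_poly_eval g x = of_int (content g) * int_poly_eval f x"
    by (metis content_times_primitive_part f_def int_poly_eval_smult)
  then have fx: "int_poly_eval f x = 0" using g g0 by (simp add: Z_def)
  have dvd: "f dvd r" if r: "int_poly_eval r x = 0" "r \<noteq> 0" for r
  proof -
    obtain a h where a: "a \<noteq> 0" "smult a r = f * h + pseudo_mod r f"
      using pseudo_mod(1)[OF f0, of r] by blast
    have "int_poly_eval (smult a r) x = 0" using r by (simp add: int_poly_eval_smult)
    \<comment> \<open>The pseudo-remainder again vanishes at \<open>x\<close> and has smaller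
      degree, so minimality forces it to be zero.\<close>
    then have "int_poly_eval (pseudo_mod r f) x = 0"
      unfolding a(2) by (simp add: int_poly_eval_add int_poly_eval_mult fx)
    moreover have "pseudo_mod r f = 0 \<or> degree (pseudo_mod r f) < degree g"
      using pseudo_mod(2)[OF f0, of r] by (simp add: f_def)
    ultimately have "pseudo_mod r f = 0"
      using g(2)[of "pseudo_mod r f"] unfolding Z_def by linarith
    then have eq: "smult a r = f * h" using a by simp
    \<comment> \<open>So far \<open>f\<close> divides only the multiple \<open>smult a r\<close>;
      Gauss's lemma strips the integer factor because \<open>f\<close> is primitive.\<close>
    have cf: "content f = 1" using g0 by (simp add: f_def)
    have "primitive_part (smult a r) = f * primitive_part h"
      using eq cf by (simp add: primitive_part_mult primitive_part_prim)
    then have "f dvd smult (unit_factor a) (primitive_part r)"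
      by (simp add: primitive_part_smult)
    moreover have "is_unit (unit_factor a)" using a by simp
    ultimately have "f dvd primitive_part r" 
      by (simp add: dvd_smult_iff a(1) unit_factor_int_def sgn_if split: if_splits)
    then show ?thesis
      by (metis content_times_primitive_part dvd_smult)
  qed
  show ?thesis using that dvd assms fx by blast
qed

section \<open>Trinomials and their reciprocals\<close>

lemma coeff_trinom: "coeff (trinom s a b) k = of_bool (k = b) + s * of_bool (k = a) - of_bool (k = 0)"
  by (auto simp: trinom_def)

lemma degree_trinom: "a < b \<Longrightarrow> degree (trinom s a b) = b"
  by (rule antisym[OF degree_le le_degree]) (auto simp: coeff_trinom)

lemma trinom_nonzero: "a < b \<Longrightarrow> trinom s a b \<noteq> 0"
  using degree_trinom[of a b s] by auto

lemma reflect_trinom: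
  assumes "0 < a" "a < b"
  shows "reflect_poly (trinom s a b) = 1 + monom s (b - a) - monom 1 b"
  using assms by (intro poly_eqI) (auto simp: coeff_reflect_poly degree_trinom coeff_trinom)

text \<open>Reversal turns the convolution at index \<open>degree p\<close> into products of equal
  coefficients. Ljunggren's argument reads off the sum of squares here.\<close>

lemma coeff_mult_reflect_poly:
  "coeff (p * reflect_poly p :: int poly) (degree p) = (\<Sum>i\<le>degree p. (coeff p i)\<^sup>2)"
  unfolding coeff_mult
  by (intro sum.cong refl) (auto simp: coeff_reflect_poly simp flip: power2_eq_square)

lemma trinom_mult_reflect:
  assumes "0 < a" "a < b" "s\<^sup>2 = 1"
  shows "trinom s a b * reflect_poly (trinom s a b) =
    monom 3 b - monom 1 (2 * b) - 1 +
    (monom s a - monom s (b - a) + monom s (2 * b - a) - monom s (b + a))"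
proof -
  \<comment> \<open>Naming the monomials turns the exponent bookkeeping into an identity in
    commuting variables with \<open>S * S = 1\<close>; three equal terms \<open>A * C\<close> give
    the middle coefficient 3.\<close>
  define A C S where "A = monom (1::int) a" "C = monom (1::int) (b - a)" "S = [:s:]"
  have mm: "monom (1::int) (i + j) = monom 1 i * monom 1 j" for i j by (simp add: mult_monom)
  have sm: "monom s i = [:s:] * monom 1 i" for i by (simp add: smult_monom)
  have m3: "monom (3::int) i = 3 * monom 1 i" for i by (simp add: numeral_poly smult_monom)
  have e: "a + (b - a) = b" "b + b = 2 * b" "b + (b - a) = 2 * b - a" using assms by auto
  have B: "monom (1::int) b = A * C" "monom (1::int) (2 * b) = (A * C) * (A * C)"
    "monom (1::int) (2 * b - a) = (A * C) * C" "monom (1::int) (b + a) = (A * C) * A"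
    using mm[of a "b - a"] mm[of b b] mm[of b "b - a"] mm[of b a]
    unfolding e A_C_S_def by simp_all
  have "S * S = 1" using assms(3) by (simp add: A_C_S_def power2_eq_square)
  then have "(A * C + S * A - 1) * (1 + S * C - A * C) =
    3 * (A * C) - (A * C) * (A * C) - 1 + (S * A - S * C + S * ((A * C) * C) - S * ((A * C) * A))"
    by algebra
  then show ?thesis unfolding reflect_trinom[OF assms(1,2)] unfolding trinom_def sm m3 B
    unfolding A_C_S_def .
qed

lemma sum_squares_eq_1:
  fixes h :: "nat \<Rightarrow> int"
  assumes "finite A" "(\<Sum>i\<in>A. (h i)\<^sup>2) = 1"
  obtains j where "j \<in> A" "(h j)\<^sup>2 = 1" "\<And>i. i \<in> A \<Longrightarrow> i \<noteq> j \<Longrightarrow> h i = 0"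
proof -
  have "int (\<Sum>i\<in>A. nat ((h i)\<^sup>2)) = 1" using assms by simp
  then have "(\<Sum>i\<in>A. nat ((h i)\<^sup>2)) = 1" by linarith
  then obtain j where j: "j \<in> A" "nat ((h j)\<^sup>2) = 1" "\<forall>i\<in>A. j \<noteq> i \<longrightarrow> nat ((h i)\<^sup>2) = 0"
    using sum_eq_1_iff[OF assms(1)] by auto
  show ?thesis
  proof (rule that[of j])
    show "(h j)\<^sup>2 = 1" using j(2) by simp
    show "h i = 0" if "i \<in> A" "i \<noteq> j" for i
      using j(3) that by fastforce
  qed fact
qed

text \<open>The extreme coefficients of the product make the end coefficients of \<open>h\<close>
  units of opposite sign, and its middle coefficient makes the squares of all coefficients sum to 3.
  Hence \<open>h\<close> is a signed trinomial, and the coefficients of the product below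
  \<open>b\<close> fix its inner exponent.\<close>

lemma trinom_characterization:
  assumes ab: "0 < a" "a < b" and H: "h * reflect_poly h = trinom (-1) a b * reflect_poly (trinom (-1) a b)"
  shows "h = trinom (-1) a b \<or> h = - trinom (-1) a b \<or>
         h = reflect_poly (trinom (-1) a b) \<or> h = - reflect_poly (trinom (-1) a b)"
proof -
  let ?P = "trinom (-1) a b"
  have P0: "coeff ?P 0 = -1" using ab by (simp add: coeff_trinom)
  have eq: "h * reflect_poly h = monom 3 b - monom 1 (2 * b) - 1 +
    (monom (-1) a - monom (-1) (b - a) + monom (-1) (2 * b - a) - monom (-1) (b + a))"
    using H trinom_mult_reflect[OF ab, of "-1"] by simp
  have c0: "coeff h 0 * lead_coeff h = -1"
    using arg_cong[OF eq, of "\<lambda>p. coeff p 0"] ab by (simp add: coeff_mult)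
  then have h0: "coeff h 0 \<noteq> 0" "h \<noteq> 0" by auto
  have "degree (h * reflect_poly h) = degree h + degree h"
    using h0 by (simp add: degree_mult_eq)
  moreover have "degree (?P * reflect_poly ?P) = b + b"
    using ab P0 trinom_nonzero[of a b "-1"] by (simp add: degree_mult_eq degree_trinom)
  ultimately have deg: "degree h = b" using H by simp
  have ne: "2 * b - a \<noteq> b" "b - a \<noteq> b" using ab by auto
  \<comment> \<open>The two end coefficients account for 2 of this 3, which leaves exactly one inner
    coefficient of square 1.\<close>
  have "(\<Sum>i\<le>b. (coeff h i)\<^sup>2) = 3"
    using coeff_mult_reflect_poly[of h] ne ab unfolding eq deg by simp
  moreover have "{..b} = insert 0 (insert b {0<..<b})" using ab by auto
  moreover have *: "coeff h 0 = 1 \<and> coeff h b = -1 \<or> coeff h 0 = -1 \<and> coeff h b = 1"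
    using c0 deg by (metis minus_equation_iff mult.commute mult_minus_left pos_zmult_eq_1_iff zmult_eq_1_iff)
  ultimately have "(\<Sum>i\<in>{0<..<b}. (coeff h i)\<^sup>2) = 1" using ab by auto
  then obtain j where j: "j \<in> {0<..<b}" "(coeff h j)\<^sup>2 = 1" "\<And>i. i \<in> {0<..<b} \<Longrightarrow> i \<noteq> j \<Longrightarrow> coeff h i = 0"
    by (rule sum_squares_eq_1[rotated]) auto
  \<comment> \<open>As \<open>e\<close> is a unit, multiplying by it normalizes \<open>h\<close> to
    leading coefficient 1, inner coefficient \<open>s\<close> and constant term -1.\<close>
  define e where "e = coeff h b"
  define s where "s = e * coeff h j"
  have e: "e\<^sup>2 = 1" "e = 1 \<or> e = -1" using * by (auto simp: e_def)
  have s: "s\<^sup>2 = 1" using e j by (simp add: s_def power_mult_distrib)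
  then have s': "s = 1 \<or> s = -1" using power2_eq_1_iff by blast
  have ce: "coeff h k = 0" if "k > b" for k using that deg coeff_eq_0 by auto
  have hs: "h = smult e (trinom s j b)"
  proof (rule poly_eqI)
    fix k
    have "e * (e * coeff h j) = coeff h j" using e by (metis mult.assoc mult_1 power2_eq_square)
    then show "coeff h k = coeff (smult e (trinom s j b)) k"
      using j(1) j(3)[of k] ce[of k] * by (cases "k = 0"; cases "k = b"; cases "k = j"; cases "k < b") 
        (auto simp: coeff_trinom e_def s_def)
  qed
  have "h * reflect_poly h = trinom s j b * reflect_poly (trinom s j b)"
    unfolding hs using e by (auto simp: reflect_poly_smult)
  also have "\<dots> = monom 3 b - monom 1 (2 * b) - 1 +
    (monom s j - monom s (b - j) + monom s (2 * b - j) - monom s (b + j))"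
    by (rule trinom_mult_reflect) (use j s in auto)
  finally have "monom 3 b - monom 1 (2 * b) - 1 +
    (monom s j - monom s (b - j) + monom s (2 * b - j) - monom s (b + j)) =
    monom 3 b - monom 1 (2 * b) - 1 +
    (monom (-1) a - monom (-1) (b - a) + monom (-1) (2 * b - a) - monom (-1) (b + a))"
    unfolding eq by (rule sym)
  then have eq2: "monom s j - monom s (b - j) + monom s (2 * b - j) - monom s (b + j) =
    monom (-1) a - monom (-1) (b - a) + monom (-1) (2 * b - a) - monom (-1) (b + a)"
    by (rule add_left_imp_eq)
  \<comment> \<open>The terms of exponent above \<open>b\<close> drop out, leaving only the
    exponents \<open>j\<close>, \<open>b - j\<close>, \<open>a\<close> and
    \<open>b - a\<close>.\<close>
  have cf: "s * (of_bool (j = k) - of_bool (b - j = k)) = of_bool (b - a = k) - of_bool (a = k)" if "k < b" for k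
  proof -
    have "2 * b - j \<noteq> k" "b + j \<noteq> k" "2 * b - a \<noteq> k" "b + a \<noteq> k"
      using that ab j(1) by auto
    moreover have "coeff (monom s j) k - coeff (monom s (b - j)) k + coeff (monom s (2 * b - j)) k - coeff (monom s (b + j)) k =
      coeff (monom (-1) a) k - coeff (monom (-1) (b - a)) k + coeff (monom (-1) (2 * b - a)) k - coeff (monom (-1) (b + a)) k"
      using arg_cong[OF eq2, of "\<lambda>p. coeff p k"] by (simp only: coeff_add coeff_diff)
    ultimately have "(if j = k then s else 0) - (if b - j = k then s else 0) =
      (if a = k then -1 else 0) - (if b - a = k then -1 else 0)"
      by (simp only: coeff_monom if_False)
    moreover have "s * (of_bool A - of_bool B) = of_bool D - of_bool C"
      if "(if A then s else 0) - (if B then s else 0) = (if C then -1 else 0) - (if D then -1 else 0)" for A B C D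
      using that by (cases A; cases B; cases C; cases D) auto
    ultimately show ?thesis by blast
  qed
  have "s = -1 \<and> j = a \<or> s = 1 \<and> j = b - a"
  proof (cases "j = a")
    case True
    then have "s * (1 - of_bool (b - a = a)) = of_bool (b - a = a) - 1"
      using cf[of a] ab by simp
    then show ?thesis using True s' by (cases "b - a = a") auto
  next
    case False
    have "b - j = a"
    proof (rule ccontr)
      \<comment> \<open>Then the coefficient at \<open>a\<close> forces \<open>b = 2 * a\<close>, so
        the right side of \<open>cf\<close> vanishes everywhere, while its left side does not vanish
        at \<open>j\<close>.\<close>
      assume "b - j \<noteq> a"
      then have "b - a = a" using cf[of a] False ab by (simp split: if_splits)
      then show False using cf[of j] False \<open>b - j \<noteq> a\<close> j(1) ab s' by (cases "b - j = j") auto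
    qed
    moreover have "b - a \<noteq> a" using False calculation j(1) ab by auto
    ultimately have "s = 1" using cf[of a] False ab by simp
    then show ?thesis using \<open>b - j = a\<close> j(1) by auto
  qed
  moreover have "trinom 1 (b - a) b = - reflect_poly ?P"
    unfolding reflect_trinom[OF ab] by (simp add: trinom_def minus_monom[symmetric])
  ultimately show ?thesis using hs e by auto
qed

text \<open>Replacing \<open>g\<close> by its reciprocal in \<open>f * g\<close> does not change the
  product with the reciprocal polynomial, so the characterization applies. Cancelling leaves
  \<open>g\<close> or \<open>f\<close> self-reciprocal up to sign, and the root \<open>x\<close>
  refutes the latter.\<close>

lemma cofactor_self_reciprocal:
  assumes ab: "0 < a" "a < b" and fg: "trinom (-1) a b = f * g"
    and x: "x > 0" "int_poly_eval f x = 0"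
  shows "reflect_poly g = g \<or> reflect_poly g = - g"
proof -
  let ?P = "trinom (-1) a b"
  have "coeff ?P 0 = -1" using ab by (simp add: coeff_trinom)
  then have c: "coeff f 0 \<noteq> 0" "coeff g 0 \<noteq> 0" unfolding fg by (auto simp: coeff_mult)
  have f0: "f \<noteq> 0" "g \<noteq> 0" using c by auto
  define h where "h = f * reflect_poly g"
  have "h * reflect_poly h = ?P * reflect_poly ?P"
    unfolding h_def fg using c by (simp add: reflect_poly_mult algebra_simps)
  from trinom_characterization[OF ab this]
  have "f * reflect_poly g = f * g \<or> f * reflect_poly g = f * (- g) \<or>
    reflect_poly g * f = reflect_poly g * reflect_poly f \<or> reflect_poly g * f = reflect_poly g * (- reflect_poly f)"
    unfolding h_def fg by (simp add: reflect_poly_mult mult.commute)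
  then consider "reflect_poly g = g \<or> reflect_poly g = - g" | "reflect_poly f = f \<or> reflect_poly f = - f"
    using f0 by (metis mult_left_cancel reflect_poly_eq_0_iff minus_minus)
  then show ?thesis
  proof cases
    case 2
    have "int_poly_eval (reflect_poly f) x = 0"
      using 2 x int_poly_eval_diff[of 0 f x] by auto
    then have "int_poly_eval f (1 / x) = 0" using x by (simp add: int_poly_eval_reflect)
    then have 1: "int_poly_eval ?P (1 / x) = 0" unfolding fg by (simp add: int_poly_eval_mult)
    have 2: "int_poly_eval ?P x = 0" unfolding fg using x by (simp add: int_poly_eval_mult)
    \<comment> \<open>Vanishing at both \<open>x\<close> and \<open>1 / x\<close> would make
      \<open>x ^ b\<close> and \<open>(1 / x) ^ b\<close> both exceed 1, yet their product is
      1.\<close>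
    have b: "x ^ b = 1 + x ^ a" "(1/x) ^ b = 1 + (1/x) ^ a" using 1 2 by (auto simp: int_poly_eval_trinom)
    have "x ^ b > 1" "(1/x) ^ b > 1" unfolding b using x by auto
    then have "x ^ b * (1 / x) ^ b > 1" by (metis less_1_mult)
    then show ?thesis using x by (simp add: power_one_over)
  qed auto
qed

text \<open>With a common factor \<open>f\<close> and cofactors \<open>g\<close>, \<open>k\<close>
  that are self-reciprocal up to sign, each side is, up to sign, the product of \<open>f\<close>,
  its reciprocal, \<open>g\<close> and \<open>k\<close>.\<close>

lemma trinom_common_root_identity:
  assumes ab: "0 < a" "a < b" and nm: "0 < n" "n < m"
    and x: "x > 0" "x ^ b - x ^ a = (1::real)" "x ^ m - x ^ n = 1"
  shows "trinom (-1) a b * reflect_poly (trinom (-1) n m) =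
         reflect_poly (trinom (-1) a b) * trinom (-1) n m"
proof -
  let ?P = "trinom (-1) a b" and ?Q = "trinom (-1) n m"
  have root: "int_poly_eval ?P x = 0" "int_poly_eval ?Q x = 0"
    using x by (simp_all add: int_poly_eval_trinom)
  obtain f where f: "f dvd ?P" "f dvd ?Q" "int_poly_eval f x = 0"
    using common_root_imp_common_factor[OF trinom_nonzero[OF ab(2)] root(1) trinom_nonzero[OF nm(2)] root(2)]
    by blast
  then obtain g k where g: "?P = f * g" and k: "?Q = f * k" by (auto elim!: dvdE)
  have "reflect_poly g = g \<or> reflect_poly g = - g" "reflect_poly k = k \<or> reflect_poly k = - k"
    using cofactor_self_reciprocal[OF ab g x(1) f(3)] cofactor_self_reciprocal[OF nm k x(1) f(3)] by auto
  then have eq: "?P * reflect_poly ?Q = reflect_poly ?P * ?Q \<or> ?P * reflect_poly ?Q = - (reflect_poly ?P * ?Q)"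
    unfolding g k reflect_poly_mult by (elim disjE) (simp_all add: mult_ac)
  \<comment> \<open>The value at 1 excludes the minus sign.\<close>
  have "poly (?P * reflect_poly ?Q) 1 = 1" "poly (reflect_poly ?P * ?Q) 1 = 1"
    unfolding reflect_trinom[OF ab] reflect_trinom[OF nm] by (simp_all add: trinom_def poly_monom)
  then have "\<not> ?P * reflect_poly ?Q = - (reflect_poly ?P * ?Q)"
    by (metis poly_minus one_neq_neg_one)
  then show ?thesis using eq by blast
qed

text \<open>After cancellation the identity equates two sums of five monomials, so their exponents
  coincide as multisets. Matching them yields equal pairs or a common multiple of the plastic
  coincidence, and coprimality of \<open>a\<close> and \<open>b\<close> reduces that multiple to
  1.\<close>

lemma trinom_common_root:
  assumes ab: "0 < a" "a < b" and nm: "0 < n" "n < m" and cop: "coprime a b"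
    and x: "x > 0" "x ^ b - x ^ a = (1::real)" "x ^ m - x ^ n = 1"
  shows "a = n \<and> b = m \<or> a = 1 \<and> b = 3 \<and> n = 4 \<and> m = 5 \<or> a = 4 \<and> b = 5 \<and> n = 1 \<and> m = 3"
proof -
  define c l where "c = b - a" and "l = m - n"
  have b: "b = a + c" "c > 0" and m: "m = n + l" "l > 0" using ab nm by (auto simp: c_def l_def)
  have id: "monom 1 n + monom 1 l + monom 1 (n+l+c) + monom 1 (l+a) + monom 1 (n+l+a) =
     monom 1 a + monom 1 c + monom 1 (l+a+c) + monom 1 (c+n) + monom (1::int) (a+c+n)"
  proof -
    define A C N L :: "int poly" where "A = monom 1 a" "C = monom 1 c" "N = monom 1 n" "L = monom 1 l"
    have mm: "monom (1::int) (i + j) = monom 1 i * monom 1 j" for i j by (simp add: mult_monom)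
    have neg: "monom (-1) i = - monom (1::int) i" for i by (simp add: minus_monom)
    have "trinom (-1) a b = A * C - A - 1" "trinom (-1) n m = N * L - N - 1"
      unfolding trinom_def b(1) m(1) mm neg A_C_N_L_def by (simp_all only: diff_conv_add_uminus)
    moreover have "reflect_poly (trinom (-1) a b) = 1 - C - A * C"
      "reflect_poly (trinom (-1) n m) = 1 - L - N * L"
      unfolding reflect_trinom[OF ab] reflect_trinom[OF nm] unfolding b(1) m(1) add_diff_cancel_left'
      unfolding mm neg A_C_N_L_def by (simp_all only: diff_conv_add_uminus)
    ultimately have "(A * C - A - 1) * (1 - L - N * L) = (1 - C - A * C) * (N * L - N - 1)"
      using trinom_common_root_identity[OF ab nm x] by simp
    then have "N + L + N * L * C + L * A + N * L * A = A + C + L * A * C + C * N + A * C * N"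
      by algebra
    then show ?thesis unfolding mm A_C_N_L_def .
  qed
  have cf: "(of_bool (n = k) :: int) + of_bool (l = k) + of_bool (n+l+c = k) + of_bool (l+a = k) + of_bool (n+l+a = k) =
     of_bool (a = k) + of_bool (c = k) + of_bool (l+a+c = k) + of_bool (c+n = k) + of_bool (a+c+n = k)" for k
    using arg_cong[OF id, of "\<lambda>p. coeff p k"] by (simp only: coeff_add coeff_monom of_bool_def)
  have "(n = a \<and> l = c) \<or> (n = c \<and> l = 2 * c \<and> a = 4 * c) \<or> (a = l \<and> c = 2 * l \<and> n = 4 * l)"
  proof -
    \<comment> \<open>The derivative at 1 of a sum of monomials with coefficient 1 is the sum of the
      exponents.\<close>
    have eval: "poly (pderiv (monom 1 k)) 1 = int k" for k
      by (simp add: pderiv_monom poly_monom)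
    have "int n + int l + int (n+l+c) + int (l+a) + int (n+l+a) =
       int a + int c + int (l+a+c) + int (c+n) + int (a+c+n)"
      using arg_cong[OF id, of "\<lambda>p. poly (pderiv p) 1"]
      unfolding pderiv_add poly_add eval .
    then have s: "n + 3 * l = a + 3 * c" by simp
    \<comment> \<open>Each of the exponents \<open>n\<close> and \<open>l\<close> must occur on the
      right side of \<open>id\<close>, and \<open>a\<close> on the left.\<close>
    have N: "n = a \<or> n = c \<or> n = l+a+c \<or> n = c+n \<or> n = a+c+n"
      by (rule ccontr, use cf[of n] in \<open>auto simp: of_bool_def split: if_splits\<close>)
    have L: "l = a \<or> l = c \<or> l = l+a+c \<or> l = c+n \<or> l = a+c+n"
      by (rule ccontr, use cf[of l] in \<open>auto simp: of_bool_def split: if_splits\<close>)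
    have A: "a = n \<or> a = l \<or> a = n+l+c \<or> a = l+a \<or> a = n+l+a"
      by (rule ccontr, use cf[of a] in \<open>auto simp: of_bool_def split: if_splits\<close>)
    have pos: "c > 0" "l > 0" "a > 0" using b(2) m(2) ab(1) by auto
    from N show ?thesis
    proof (elim disjE)
      assume "n = c"
      with L s pos show ?thesis by (elim disjE) linarith+
    next
      assume "n = l + a + c"
      with A s pos show ?thesis by (elim disjE) linarith+
    qed (use s pos in linarith)+
  qed
  then show ?thesis
  proof (elim disjE conjE)
    assume "n = c" "l = 2 * c" "a = 4 * c"
    moreover from this have "c dvd a" "c dvd b" by (auto simp: b)
    then have "c = 1" using cop by (meson coprime_common_divisor_nat nat_dvd_1_iff_1 coprime_def)
    ultimately show ?thesis by (simp add: b m)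
  next
    assume "a = l" "c = 2 * l" "n = 4 * l"
    moreover from this have "l dvd a" "l dvd b" by (auto simp: b)
    then have "l = 1" using cop by (meson coprime_common_divisor_nat nat_dvd_1_iff_1 coprime_def)
    ultimately show ?thesis by (simp add: b m)
  qed (auto simp: b m)
qed

text \<open>This serves to exclude \<open>n = 0\<close> in \<open>x ^ m - x ^ n = 1\<close>. Modulo
  2, \<open>x^m - 2\<close> becomes \<open>x^m\<close>, while a common factor has odd constant term
  because it divides a polynomial with constant term -1; hence such a factor would be
  constant.\<close>

lemma trinom_root_power_neq_2:
  assumes ab: "0 < a" "a < b" and x: "x ^ b - x ^ a = (1::real)"
  shows "x ^ m \<noteq> 2"
proof
  assume m: "x ^ m = 2"
  let ?P = "trinom (-1) a b"
  define Q :: "int poly" where "Q = monom 1 m - monom 2 0"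
  have m0: "m > 0" using m by (cases m) auto
  have cQ: "coeff Q k = of_bool (k = m) - 2 * of_bool (k = 0)" for k
    by (auto simp: Q_def)
  have "coeff Q m \<noteq> 0" using m0 by (simp add: cQ)
  then have Q0: "Q \<noteq> 0" by auto
  have root: "int_poly_eval ?P x = 0" "int_poly_eval Q x = 0"
    using x m by (simp_all add: int_poly_eval_trinom Q_def int_poly_eval_diff int_poly_eval_monom)
  obtain f where f: "f dvd ?P" "f dvd Q" "int_poly_eval f x = 0"
    using common_root_imp_common_factor[OF trinom_nonzero[OF ab(2)] root(1) Q0 root(2)]
    by blast
  then obtain g k where g: "?P = f * g" and k: "Q = f * k" by (auto elim!: dvdE)
  have "coeff f 0 * coeff g 0 = -1"
    using arg_cong[OF g, of "\<lambda>p. coeff p 0"] ab by (simp add: coeff_trinom coeff_mult)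
  then have of0: "odd (coeff f 0)" by (metis dvd_mult2 dvd_minus_iff odd_one)
  have "lead_coeff f * lead_coeff k = lead_coeff Q" unfolding k by (simp add: lead_coeff_mult)
  moreover have dQ: "degree Q = m"
    by (rule antisym[OF degree_le le_degree]) (use m0 in \<open>auto simp: cQ\<close>)
  ultimately have "lead_coeff f * lead_coeff k = 1" using m0 by (simp add: cQ)
  then have "odd (lead_coeff k)" by (metis dvd_mult odd_one)
  then have ex: "\<exists>i. odd (coeff k i)" by blast
  \<comment> \<open>The first odd coefficient of \<open>k\<close> meets the odd constant term of
    \<open>f\<close>, so \<open>Q\<close> has an odd coefficient at \<open>j\<close>. Its only one
    is at \<open>m\<close>, so \<open>k\<close> takes up the whole degree of
    \<open>Q\<close>.\<close>
  define j where "j = (LEAST i. odd (coeff k i))"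
  have j: "odd (coeff k j)" "\<And>i. i < j \<Longrightarrow> even (coeff k i)"
    unfolding j_def using LeastI_ex[OF ex] not_less_Least by blast+
  have "coeff Q j = coeff f 0 * coeff k j + (\<Sum>i\<in>{0<..j}. coeff f i * coeff k (j - i))"
  proof -
    have "{..j} = insert 0 {0<..j}" by auto
    then show ?thesis unfolding k coeff_mult by simp
  qed
  moreover have "even (\<Sum>i\<in>{0<..j}. coeff f i * coeff k (j - i))"
    by (rule dvd_sum) (use j in auto)
  ultimately have "odd (coeff Q j)" using of0 j by simp
  then have "j = m" unfolding cQ by (auto split: if_splits)
  moreover have "j \<le> degree k" using j(1) by (intro le_degree) auto
  moreover have "degree f + degree k = m" using Q0 dQ unfolding k by (auto simp: degree_mult_eq)
  ultimately have "degree f = 0" by simp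
  then have "int_poly_eval f x = coeff f 0" by (simp add: int_poly_eval_altdef)
  then show False using f(3) of0 by auto
qed

section \<open>Products built from triads\<close>

definition triads :: "real \<Rightarrow> (real \<times> real) set" where
  "triads lam = {(p, q). p \<in> lattice lam \<and> q \<in> lattice lam \<and> p + q = 1}"

text \<open>A triad is a triple \<open>(p, q, -1)\<close> of sum zero, normalized by scaling; the
  two involutions generate the permutations of this triple.\<close>

definition invariant_weight :: "real \<Rightarrow> (real \<times> real \<Rightarrow> real) \<Rightarrow> bool" where
  "invariant_weight lam w \<longleftrightarrow>
     (\<forall>p q. (p, q) \<in> triads lam \<longrightarrow> w (q, p) = w (p, q) \<and> w (1 / p, - q / p) = w (p, q))"

definition triad_op ::
  "real \<Rightarrow> (real \<times> real \<Rightarrow> real) \<Rightarrow> (real \<Rightarrow> complex) \<Rightarrow> (real \<Rightarrow> complex) \<Rightarrow> real \<Rightarrow> complex" where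
  "triad_op lam w f g = (\<lambda>k. if k \<in> lattice lam
     then \<Sum>(p, q)\<in>triads lam. of_real (w (p, q)) * (f (p * k) * g (q * k)) else 0)"

text \<open>For nonzero \<open>p\<close>, these are the Fourier coefficients of
  \<open>x \<mapsto> 2 Re (z exp (i p x))\<close>; the reality condition forces the value at
  \<open>- p\<close>.\<close>

definition mode :: "real \<Rightarrow> complex \<Rightarrow> real \<Rightarrow> complex" where
  "mode p z = (\<lambda>k. if k = p then z else if k = - p then cnj z else 0)"

section \<open>Absolutely summable functions on the lattice\<close>

lemma abs_summable_on_finite_sum:
  fixes F :: "'a \<Rightarrow> 'b \<Rightarrow> complex"
  assumes "finite S" "\<And>x. x \<in> S \<Longrightarrow> (\<lambda>k. norm (F x k)) summable_on A"
  shows "(\<lambda>k. norm (\<Sum>x\<in>S. F x k)) summable_on A"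
proof -
  have "(\<lambda>k. \<Sum>x\<in>S. norm (F x k)) summable_on A"
    using assms by (induction S) (auto intro!: summable_on_add)
  then show ?thesis
    by (rule summable_on_comparison_test) (auto intro: norm_sum)
qed

lemma infsum_finite_sum:
  fixes F :: "'a \<Rightarrow> 'b \<Rightarrow> complex"
  assumes "finite S" "\<And>x. x \<in> S \<Longrightarrow> F x summable_on A"
  shows "(\<lambda>k. \<Sum>x\<in>S. F x k) summable_on A \<and>
    infsum (\<lambda>k. \<Sum>x\<in>S. F x k) A = (\<Sum>x\<in>S. infsum (F x) A)"
  using assms by (induction S) (auto intro!: summable_on_add simp: infsum_add)

lemma lattice_1: "1 \<in> lattice lam"
  by (auto simp: lattice_def intro!: exI[of _ 0])

lemma lattice_uminus_iff [simp]: "- k \<in> lattice lam \<longleftrightarrow> k \<in> lattice lam"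
proof -
  have "- k \<in> lattice lam" if "k \<in> lattice lam" for k using that by (auto simp: lattice_def)
  from this[of k] this[of "- k"] show ?thesis by auto
qed

lemma powi_in_lattice [simp]: "lam powi n \<in> lattice lam"
  by (auto simp: lattice_def)

lemma power_in_lattice [simp]: "lam ^ n \<in> lattice lam"
  using powi_in_lattice[of lam "int n"] by (simp del: powi_in_lattice)

lemma lattice_E:
  assumes "k \<in> lattice lam"
  obtains n where "k = lam powi n" | n where "k = - (lam powi n)"
  using assms by (auto simp: lattice_def)

text \<open>The classification determines a product only on the algebra, so the axioms must transfer
  between operations that agree there. The closure assumptions keep the arguments formed by
  linearity, scaling and parity inside the algebra.\<close>

lemma symmetric_product_cong:
  assumes "\<And>f g. f \<in> algA lam \<Longrightarrow> g \<in> algA lam \<Longrightarrow> op f g = op' f g"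
    and op': "symmetric_product lam op'"
    and closed: "\<And>f g \<gamma>. f \<in> algA lam \<Longrightarrow> g \<in> algA lam \<Longrightarrow> (\<lambda>k. f k + complex_of_real \<gamma> * g k) \<in> algA lam"
      "\<And>f. f \<in> algA lam \<Longrightarrow> dil lam f \<in> algA lam"
      "\<And>f. f \<in> algA lam \<Longrightarrow> f \<circ> uminus \<in> algA lam"
  shows "symmetric_product lam op"
  using op' unfolding symmetric_product_def
  by (elim conjE, intro conjI) (simp_all add: assms(1) closed)

locale log_lattice =
  fixes lam :: real
  assumes lam_pos: "lam > 0"
begin

abbreviation "L \<equiv> lattice lam"
abbreviation "A \<equiv> algA lam"

lemma lattice_nonzero: "k \<in> L \<Longrightarrow> k \<noteq> 0"
  using lam_pos by (auto simp: lattice_def)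

lemma lattice_mult: "j \<in> L \<Longrightarrow> k \<in> L \<Longrightarrow> j * k \<in> L"
  using lam_pos by (elim lattice_E) (simp_all flip: power_int_add)

lemma lattice_inverse: "k \<in> L \<Longrightarrow> inverse k \<in> L"
  by (elim lattice_E) (simp_all flip: power_int_minus)

lemma lattice_divide: "j \<in> L \<Longrightarrow> k \<in> L \<Longrightarrow> j / k \<in> L"
  by (simp add: divide_inverse lattice_inverse lattice_mult)

lemma lattice_mult_iff: "p \<in> L \<Longrightarrow> p * k \<in> L \<longleftrightarrow> k \<in> L"
  using lattice_mult[of p k] lattice_divide[of "p * k" p] lattice_nonzero by auto

lemma lam_in_lattice: "lam \<in> L"
  using power_in_lattice[of lam 1] by simp

lemma bij_betw_mult_lattice: "p \<in> L \<Longrightarrow> bij_betw (\<lambda>k. p * k) L L"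
  by (rule bij_betwI[of _ _ _ "\<lambda>k. k / p"])
     (auto simp: lattice_mult lattice_divide lattice_nonzero)

lemma algA_outside: "f \<in> A \<Longrightarrow> k \<notin> L \<Longrightarrow> f k = 0"
  and algA_summable: "f \<in> A \<Longrightarrow> (\<lambda>k. norm (f k)) summable_on L"
  and algA_uminus: "f \<in> A \<Longrightarrow> f (- k) = cnj (f k)"
  by (auto simp: algA_def)

lemma algA_linear:
  assumes "f \<in> A" "g \<in> A"
  shows "(\<lambda>k. f k + complex_of_real \<gamma> * g k) \<in> A"
proof -
  have "(\<lambda>k. norm (f k) + \<bar>\<gamma>\<bar> * norm (g k)) summable_on L"
    using assms by (intro summable_on_add summable_on_cmult_right algA_summable)
  then have "(\<lambda>k. norm (f k + complex_of_real \<gamma> * g k)) summable_on L"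
    by (rule summable_on_comparison_test) (auto intro: norm_triangle_mono simp: norm_mult)
  then show ?thesis using assms by (simp add: algA_def)
qed

lemma algA_shift_summable:
  assumes "f \<in> A" "p \<in> L"
  shows "(\<lambda>k. norm (f (p * k))) summable_on L"
  using summable_on_reindex_bij_betw[OF bij_betw_mult_lattice[OF assms(2)], of "\<lambda>k. norm (f k)"]
    algA_summable[OF assms(1)] by simp

lemma algA_dil: "f \<in> A \<Longrightarrow> dil lam f \<in> A"
  using algA_shift_summable[of f lam] lattice_mult_iff[of lam]
  by (auto simp: algA_def dil_def lam_in_lattice)

lemma algA_comp_uminus: "f \<in> A \<Longrightarrow> f \<circ> uminus \<in> A"
  by (simp add: algA_def)

lemma algA_bounded:
  assumes "f \<in> A"
  obtains B where "\<And>k. norm (f k) \<le> B"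
proof (rule that)
  fix k
  show "norm (f k) \<le> (\<Sum>\<^sub>\<infinity>k\<in>L. norm (f k))"
  proof (cases "k \<in> L")
    case True
    then show ?thesis
      using finite_sum_le_infsum[OF algA_summable[OF assms], of "{k}"] by simp
  next
    case False
    then show ?thesis using algA_outside[OF assms] by (simp add: infsum_nonneg)
  qed
qed

lemma abs_summable_mult_algA:
  assumes F: "(\<lambda>k. norm (F k :: complex)) summable_on L" and "g \<in> A"
  shows "(\<lambda>k. norm (F k * g (h k))) summable_on L"
proof -
  obtain B where B: "\<And>k. norm (g k) \<le> B" using algA_bounded[OF assms(2)] by blast
  have "(\<lambda>k. norm (F k) * B) summable_on L" using F by (rule summable_on_cmult_left)
  then show ?thesis
    by (rule summable_on_comparison_test) (auto simp: norm_mult intro!: mult_left_mono B)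
qed

lemma mode_in_algA: 
  assumes "p \<in> L"
  shows "mode p z \<in> A"
proof -
  have "(\<lambda>k. norm (mode p z k)) summable_on {p, - p}" by simp
  then have "(\<lambda>k. norm (mode p z k)) summable_on L"
    by (rule summable_on_cong_neutral[THEN iffD1, rotated -1]) (use assms in \<open>auto simp: mode_def\<close>)
  then show ?thesis using assms lattice_nonzero[OF assms] by (auto simp: algA_def mode_def)
qed

lemma ip_mode:
  assumes "f \<in> A" "p \<in> L"
  shows "ip lam f (mode p z) = of_real (2 * Re (f p * cnj z))"
    and "ip lam (mode p z) f = of_real (2 * Re (f p * cnj z))"
proof -
  have p0: "p \<noteq> - p" using lattice_nonzero[OF assms(2)] by simp
  have "ip lam f (mode p z) = (\<Sum>\<^sub>\<infinity>k\<in>{p, - p}. f k * cnj (mode p z k))"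
    unfolding ip_def by (rule infsum_cong_neutral) (use assms in \<open>auto simp: mode_def\<close>)
  also have "\<dots> = f p * cnj z + cnj (f p * cnj z)"
    using p0 by (simp add: mode_def algA_uminus[OF assms(1)])
  finally show 1: "ip lam f (mode p z) = of_real (2 * Re (f p * cnj z))"
    unfolding complex_add_cnj .
  have "ip lam (mode p z) f = cnj (ip lam f (mode p z))"
    unfolding ip_def by (subst infsum_cnj[symmetric]) (simp add: mult.commute)
  then show "ip lam (mode p z) f = of_real (2 * Re (f p * cnj z))"
    unfolding 1 by simp
qed

text \<open>Pairing with \<open>mode p z\<close> for \<open>z = 1\<close> and
  \<open>z = \<i>\<close> recovers the real and imaginary parts of the value at
  \<open>p\<close>.\<close>

lemma algA_eqI:
  assumes "f \<in> A" "g \<in> A" and eq: "\<And>p z. p \<in> L \<Longrightarrow> ip lam f (mode p z) = ip lam g (mode p z)"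
  shows "f = g"
proof
  fix k
  show "f k = g k"
  proof (cases "k \<in> L")
    case True
    then have "Re (f k * cnj z) = Re (g k * cnj z)" for z
      using eq[OF True, of z] unfolding ip_mode(1)[OF assms(1) True] ip_mode(1)[OF assms(2) True] of_real_eq_iff
      by simp
    from this[of 1] this[of \<i>] show ?thesis by (simp add: complex_eq_iff)
  qed (simp add: algA_outside assms)
qed

text \<open>Averaged associativity moves both arguments onto single modes, which replaces
  the continuity needed to expand general elements of the algebra into modes.\<close>
lemma symmetric_product_eqI:
  assumes op: "symmetric_product lam op" and op': "symmetric_product lam op'"
    and modes: "\<And>p q z w. p \<in> L \<Longrightarrow> q \<in> L \<Longrightarrow> op (mode p z) (mode q w) = op' (mode p z) (mode q w)"
    and "f \<in> A" "g \<in> A"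
  shows "op f g = op' f g"
proof -
  note D = op[unfolded symmetric_product_def] op'[unfolded symmetric_product_def]
  have closed: "op f g \<in> A" "op' f g \<in> A" if "f \<in> A" "g \<in> A" for f g using D that by simp_all
  have assoc: "ip lam (op f g) h = ip lam f (op g h)" "ip lam (op' f g) h = ip lam f (op' g h)"
    if "f \<in> A" "g \<in> A" "h \<in> A" for f g h using D that by simp_all
  have 1: "op g (mode k v) = op' g (mode k v)" if "g \<in> A" "k \<in> L" for g k v
    by (rule algA_eqI) (use that in \<open>simp_all add: closed mode_in_algA assoc modes\<close>)
  show ?thesis
    by (rule algA_eqI) (use assms(4,5) in \<open>simp_all add: closed mode_in_algA assoc 1\<close>)
qed


section \<open>Symmetries of the set of triads\<close>

lemma triads_swap: "(p, q) \<in> triads lam \<Longrightarrow> (q, p) \<in> triads lam"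
  by (auto simp: triads_def)

lemma triads_inverse:
  assumes "(p, q) \<in> triads lam"
  shows "(1 / p, - q / p) \<in> triads lam"
proof -
  have "p \<in> L" "q \<in> L" "p + q = 1" using assms by (auto simp: triads_def)
  moreover from this have "1 / p \<in> L" "q / p \<in> L" by (simp_all add: lattice_divide lattice_1)
  moreover have "1 / p - q / p = 1"
    using calculation lattice_nonzero[of p] by (simp add: field_simps)
  ultimately show ?thesis by (simp add: triads_def)
qed

lemma triads_rotate: "(p, q) \<in> triads lam \<Longrightarrow> (- q / p, 1 / p) \<in> triads lam"
  by (rule triads_swap, rule triads_inverse)

lemma triads_D:
  assumes "(p, q) \<in> triads lam"
  shows "p \<in> L" "q \<in> L" "p \<noteq> 0" "q \<noteq> 0" "q = 1 - p"
  using assms lattice_nonzero[of p] lattice_nonzero[of q] by (auto simp: triads_def)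

lemma triads_sum: "(p, q) \<in> triads lam \<Longrightarrow> p + q = 1"
  by (simp add: triads_def)

text \<open>This is a cyclic permutation of \<open>(p, q, -1)\<close> up to scaling; the inverse map
  is the other cyclic permutation.\<close>

lemma bij_betw_triads_rotate: "bij_betw (\<lambda>(p, q). (- q / p, 1 / p)) (triads lam) (triads lam)"
proof (rule bij_betwI[of _ _ _ "\<lambda>(p, q). (1 / q, - p / q)"])
  show "(\<lambda>(p, q). (- q / p, 1 / p)) \<in> triads lam \<rightarrow> triads lam"
    by (rule Pi_I, clarify, rule triads_rotate)
  show "(\<lambda>(p, q). (1 / q, - p / q)) \<in> triads lam \<rightarrow> triads lam"
    by (rule Pi_I, clarify, rule triads_inverse, rule triads_swap)
qed (auto dest: triads_D(3,4))

section \<open>Weighted triad sums satisfy the axioms\<close>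

context
  fixes w
  assumes finite_triads: "finite (triads lam)" and w: "invariant_weight lam w"
begin

lemma triad_op_outside: "k \<notin> L \<Longrightarrow> triad_op lam w f g k = 0"
  by (simp add: triad_op_def)

lemma triad_op_in: "k \<in> L \<Longrightarrow> triad_op lam w f g k =
    (\<Sum>(p, q)\<in>triads lam. of_real (w (p, q)) * (f (p * k) * g (q * k)))"
  by (simp add: triad_op_def)

lemma triad_term_summable:
  assumes "f \<in> A" "g \<in> A" "p \<in> L"
  shows "(\<lambda>k. norm (of_real c * (f (p * k) * g (q * k)))) summable_on L"
  using summable_on_cmult_right[OF abs_summable_mult_algA[OF algA_shift_summable[OF assms(1,3)] assms(2),
    of "\<lambda>k. q * k"], of "\<bar>c\<bar>"]
  by (simp add: norm_mult)

lemma triad_op_in_algA: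
  assumes "f \<in> A" "g \<in> A"
  shows "triad_op lam w f g \<in> A"
proof -
  have "(\<lambda>k. norm (\<Sum>(p, q)\<in>triads lam. of_real (w (p, q)) * (f (p * k) * g (q * k)))) summable_on L"
    using finite_triads triad_term_summable[OF assms]
    by (intro abs_summable_on_finite_sum) (auto simp: split_beta dest: triads_D(1))
  then have "(\<lambda>k. norm (triad_op lam w f g k)) summable_on L"
    by (rule summable_on_cong[THEN iffD1, rotated]) (simp add: triad_op_in)
  moreover have "triad_op lam w f g (- k) = cnj (triad_op lam w f g k)" for k
    by (simp add: triad_op_def split_beta algA_uminus[OF assms(1)] algA_uminus[OF assms(2)])
  ultimately show ?thesis by (simp add: algA_def triad_op_outside)
qed

lemma triad_op_commute: "triad_op lam w f g = triad_op lam w g f"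
proof -
  have "(\<Sum>(p, q)\<in>triads lam. of_real (w (p, q)) * (f (p * k) * g (q * k))) =
        (\<Sum>(p, q)\<in>triads lam. of_real (w (p, q)) * (g (p * k) * f (q * k)))" for k
  proof (rule sum.reindex_bij_witness[of _ prod.swap prod.swap])
    fix x assume x: "x \<in> triads lam"
    show "prod.swap x \<in> triads lam"
      using triads_swap[of "fst x" "snd x"] x by (simp add: prod.swap_def)
    then show "prod.swap x \<in> triads lam" .
    have "w (prod.swap x) = w x"
      using w x by (cases x) (simp add: invariant_weight_def)
    then show "(case prod.swap x of (p, q) \<Rightarrow> of_real (w (p, q)) * (g (p * k) * f (q * k))) =
        (case x of (p, q) \<Rightarrow> of_real (w (p, q)) * (f (p * k) * g (q * k)))"
      by (cases x) simp
  qed simp_all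
  then show ?thesis unfolding triad_op_def by presburger
qed

text \<open>Substituting \<open>p * k\<close> for \<open>k\<close> turns the
  \<open>(- q / p, 1 / p)\<close> term of the right side into the \<open>(p, q)\<close> term of the
  left; the reality condition on \<open>g\<close> absorbs the sign. Rotation permutes the triads and
  preserves \<open>w\<close>, so the sums over triads agree.\<close>

lemma triad_op_assoc:
  assumes "f \<in> A" "g \<in> A" "h \<in> A"
  shows "ip lam (triad_op lam w f g) h = ip lam f (triad_op lam w g h)"
proof -
  define l where "l = (\<lambda>(p, q) k. of_real (w (p, q)) * (f (p * k) * g (q * k)) * cnj (h k))"
  define r where "r = (\<lambda>(p, q) k. of_real (w (p, q)) * (f k * cnj (g (p * k) * h (q * k))))"
  have cnj_h: "(\<lambda>k. cnj (h k)) \<in> A" using assms(3) by (simp add: algA_def)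
  have cnj_g: "(\<lambda>k. cnj (g k)) \<in> A" using assms(2) by (simp add: algA_def)
  \<comment> \<open>Summability of each term permits exchanging the finite sum over triads with the
    infinite sum over the lattice.\<close>
  have l: "l x summable_on L" if x: "x \<in> triads lam" for x
  proof -
    obtain p q where x_eq: "x = (p, q)" by (cases x)
    with x have p: "p \<in> L" using triads_D(1) by blast
    show ?thesis
      unfolding x_eq l_def split
      by (rule abs_summable_summable,
          rule abs_summable_mult_algA[OF triad_term_summable[OF assms(1,2) p] cnj_h, of _ _ "\<lambda>k. k"])
  qed
  have r: "r x summable_on L" if x: "x \<in> triads lam" for x
  proof -
    have "(\<lambda>k. norm (f k * cnj (g (fst x * k)) * cnj (h (snd x * k)))) summable_on L"
      by (intro abs_summable_mult_algA[OF _ cnj_h, of _ "\<lambda>k. snd x * k"]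
          abs_summable_mult_algA[OF _ cnj_g, of _ "\<lambda>k. fst x * k"] algA_summable assms)
    then have "(\<lambda>k. of_real (w x) * (f k * cnj (g (fst x * k)) * cnj (h (snd x * k)))) summable_on L"
      by (rule summable_on_cmult_right[OF abs_summable_summable])
    then show ?thesis by (simp add: r_def split_beta mult.assoc)
  qed
  have "infsum (l x) L = infsum (r ((\<lambda>(p, q). (- q / p, 1 / p)) x)) L" if x: "x \<in> triads lam" for x
  proof -
    obtain p q where pq: "x = (p, q)" by (cases x)
    have D: "p \<in> L" "p \<noteq> 0" using x triads_D(1,3)[of p q] unfolding pq by blast+
    have w': "w (- q / p, 1 / p) = w (p, q)"
      using w x triads_inverse[of p q] unfolding pq invariant_weight_def by metis
    have "infsum (\<lambda>k. r (- q / p, 1 / p) (p * k)) L = infsum (r (- q / p, 1 / p)) L"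
      by (rule infsum_reindex_bij_betw[OF bij_betw_mult_lattice[OF D(1)]])
    moreover have "r (- q / p, 1 / p) (p * k) = l x k" for k
      unfolding pq l_def r_def split w' using D algA_uminus[OF assms(2), of "q * k"]
      by (simp add: mult.assoc)
    ultimately show ?thesis unfolding pq by simp
  qed
  then have "(\<Sum>x\<in>triads lam. infsum (l x) L) = (\<Sum>x\<in>triads lam. infsum (r x) L)"
    using sum.reindex_bij_betw[OF bij_betw_triads_rotate, of "\<lambda>x. infsum (r x) L"] by simp
  moreover have "ip lam (triad_op lam w f g) h = (\<Sum>x\<in>triads lam. infsum (l x) L)"
  proof -
    have "ip lam (triad_op lam w f g) h = infsum (\<lambda>k. \<Sum>x\<in>triads lam. l x k) L"
      unfolding ip_def by (rule infsum_cong) (simp add: triad_op_in l_def split_beta sum_distrib_right)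
    then show ?thesis using infsum_finite_sum[OF finite_triads, of l L] l by simp
  qed
  moreover have "ip lam f (triad_op lam w g h) = (\<Sum>x\<in>triads lam. infsum (r x) L)"
  proof -
    have "ip lam f (triad_op lam w g h) = infsum (\<lambda>k. \<Sum>x\<in>triads lam. r x k) L"
      unfolding ip_def
      by (rule infsum_cong) (simp add: triad_op_in r_def split_beta sum_distrib_left mult_ac)
    then show ?thesis using infsum_finite_sum[OF finite_triads, of r L] r by simp
  qed
  ultimately show ?thesis by simp
qed

lemma triad_op_linear:
  "triad_op lam w (\<lambda>k. f k + complex_of_real \<gamma> * g k) h =
    (\<lambda>k. triad_op lam w f h k + complex_of_real \<gamma> * triad_op lam w g h k)"
  by (rule ext) (simp add: triad_op_def split_beta sum_distrib_left sum.distrib[symmetric] algebra_simps)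

text \<open>In each term the factor \<open>\<i> * k\<close> splits as
  \<open>\<i> * (p * k) + \<i> * (q * k)\<close> because \<open>p + q = 1\<close>.\<close>

lemma triad_op_leibniz:
  "dlat (triad_op lam w f g) = (\<lambda>k. triad_op lam w (dlat f) g k + triad_op lam w f (dlat g) k)"
proof
  fix k
  have "\<i> * of_real k * (\<Sum>(p, q)\<in>triads lam. of_real (w (p, q)) * (f (p * k) * g (q * k))) =
     (\<Sum>(p, q)\<in>triads lam. of_real (w (p, q)) * (dlat f (p * k) * g (q * k))
        + of_real (w (p, q)) * (f (p * k) * dlat g (q * k)))"
    unfolding sum_distrib_left
  proof (intro sum.cong refl, clarify)
    fix p q assume "(p, q) \<in> triads lam"
    then have "of_real p + of_real q = (1 :: complex)" by (metis of_real_1 of_real_add triads_sum)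
    then have q: "of_real q = 1 - (of_real p :: complex)" by (simp add: eq_diff_eq add.commute)
    show "\<i> * of_real k * (of_real (w (p, q)) * (f (p * k) * g (q * k))) =
      of_real (w (p, q)) * (dlat f (p * k) * g (q * k)) + of_real (w (p, q)) * (f (p * k) * dlat g (q * k))"
      by (simp add: dlat_def q algebra_simps)
  qed
  then show "dlat (triad_op lam w f g) k = triad_op lam w (dlat f) g k + triad_op lam w f (dlat g) k"
    by (simp add: dlat_def triad_op_def split_beta sum.distrib)
qed

lemma symmetric_product_triad_op: "symmetric_product lam (triad_op lam w)"
  unfolding symmetric_product_def
proof (intro conjI ballI allI impI)
  fix f g assume fg: "f \<in> A" "g \<in> A"
  show "triad_op lam w f g \<in> A" using fg by (rule triad_op_in_algA)
  then show "triad_op lam w f g (- k) = cnj (triad_op lam w f g k)" for k by (rule algA_uminus)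
  show "triad_op lam w f g = triad_op lam w g f" by (rule triad_op_commute)
  show "dlat (triad_op lam w f g) = (\<lambda>k. triad_op lam w (dlat f) g k + triad_op lam w f (dlat g) k)"
    by (rule triad_op_leibniz)
  show "dil lam (triad_op lam w f g) = triad_op lam w (dil lam f) (dil lam g)"
    by (rule ext) (simp add: dil_def triad_op_def lattice_mult_iff[OF lam_in_lattice] mult.left_commute)
  show "triad_op lam w f g \<circ> uminus = triad_op lam w (f \<circ> uminus) (g \<circ> uminus)"
    by (rule ext) (simp add: triad_op_def)
  fix h assume h: "h \<in> A"
  show "ip lam (triad_op lam w f g) h = ip lam f (triad_op lam w g h)"
    using fg h by (rule triad_op_assoc)
  show "triad_op lam w (\<lambda>k. f k + complex_of_real \<gamma> * g k) h =
    (\<lambda>k. triad_op lam w f h k + complex_of_real \<gamma> * triad_op lam w g h k)" for \<gamma>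
    by (rule triad_op_linear)
qed

end

end

section \<open>Products on single modes\<close>

context log_lattice
begin

text \<open>The axioms give linearity over the reals only, so complex amplitudes are split. The
  right side has the shape \<open>f + \<gamma> * g\<close> twice, starting from 0, to fit the
  linearity axiom.\<close>

lemma mode_decompose:
  "mode p z = (\<lambda>k. (\<lambda>k. 0 + complex_of_real (Re z) * mode p 1 k) k + complex_of_real (Im z) * mode p \<i> k)"
  by (rule ext) (simp add: mode_def complex_eq_iff)

lemma mode_uminus: "p \<noteq> 0 \<Longrightarrow> mode (- p) z = mode p (cnj z)"
  by (rule ext) (auto simp: mode_def)

lemma mode_comp_uminus: "p \<noteq> 0 \<Longrightarrow> mode p z \<circ> uminus = mode p (cnj z)"
  by (rule ext) (auto simp: mode_def)

lemma dlat_mode: "dlat (mode p z) = mode p (\<i> * of_real p * z)"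
  by (rule ext) (simp add: mode_def dlat_def)

lemma dil_mode: "dil lam (mode p z) = mode (p / lam) z"
  using lam_pos by (intro ext) (auto simp: mode_def dil_def field_simps)

context
  fixes op
  assumes op: "symmetric_product lam op"
begin

lemma op_closed: "f \<in> A \<Longrightarrow> g \<in> A \<Longrightarrow> op f g \<in> A"
  and op_linear: "f \<in> A \<Longrightarrow> g \<in> A \<Longrightarrow> h \<in> A \<Longrightarrow>
    op (\<lambda>k. f k + complex_of_real \<gamma> * g k) h = (\<lambda>k. op f h k + complex_of_real \<gamma> * op g h k)"
  and op_commute: "f \<in> A \<Longrightarrow> g \<in> A \<Longrightarrow> op f g = op g f"
  and op_assoc: "f \<in> A \<Longrightarrow> g \<in> A \<Longrightarrow> h \<in> A \<Longrightarrow> ip lam (op f g) h = ip lam f (op g h)"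
  and op_leibniz: "f \<in> A \<Longrightarrow> g \<in> A \<Longrightarrow> dlat f \<in> A \<Longrightarrow> dlat g \<in> A \<Longrightarrow>
    dlat (op f g) = (\<lambda>k. op (dlat f) g k + op f (dlat g) k)"
  and op_dil: "f \<in> A \<Longrightarrow> g \<in> A \<Longrightarrow> dil lam (op f g) = op (dil lam f) (dil lam g)"
  and op_parity: "f \<in> A \<Longrightarrow> g \<in> A \<Longrightarrow> op f g \<circ> uminus = op (f \<circ> uminus) (g \<circ> uminus)"
  using op unfolding symmetric_product_def by simp_all

lemma op_0_left:
  assumes "h \<in> A"
  shows "op (\<lambda>k. 0) h = (\<lambda>k. 0)"
proof -
  have "op (\<lambda>k. h k + complex_of_real (- 1) * h k) h = (\<lambda>k. op h h k + complex_of_real (- 1) * op h h k)"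
    using assms by (intro op_linear)
  then show ?thesis by simp
qed

lemma op_mode_left:
  assumes "p \<in> L" "h \<in> A"
  shows "op (mode p z) h k = Re z * op (mode p 1) h k + Im z * op (mode p \<i>) h k"
proof -
  have zero: "(\<lambda>k. 0) \<in> A" by (simp add: algA_def)
  have m: "mode p 1 \<in> A" "mode p \<i> \<in> A" using assms by (simp_all add: mode_in_algA)
  have s: "(\<lambda>k. 0 + complex_of_real (Re z) * mode p 1 k) \<in> A"
    by (rule algA_linear[OF zero m(1)])
  have "op (mode p z) h =
      op (\<lambda>k. (\<lambda>k. 0 + complex_of_real (Re z) * mode p 1 k) k + complex_of_real (Im z) * mode p \<i> k) h"
    by (rule arg_cong[OF mode_decompose])
  also have "\<dots> = (\<lambda>k. op (\<lambda>k. 0 + complex_of_real (Re z) * mode p 1 k) h k + complex_of_real (Im z) * op (mode p \<i>) h k)"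
    by (rule op_linear[OF s m(2) assms(2)])
  finally show ?thesis
    unfolding op_linear[OF zero m(1) assms(2)] op_0_left[OF assms(2)] by simp
qed

lemma op_modes:
  assumes "p \<in> L" "q \<in> L"
  shows "op (mode p z) (mode q w) k =
    Re z * (Re w * op (mode p 1) (mode q 1) k + Im w * op (mode p 1) (mode q \<i>) k) +
    Im z * (Re w * op (mode p \<i>) (mode q 1) k + Im w * op (mode p \<i>) (mode q \<i>) k)"
proof -
  have m: "mode p z \<in> A" "mode q z \<in> A" for z using assms by (simp_all add: mode_in_algA)
  have "op (mode p z) (mode q w) k = Re w * op (mode p z) (mode q 1) k + Im w * op (mode p z) (mode q \<i>) k" for z
    using op_mode_left[OF assms(2) m(1)[of z], of w k] op_commute[OF m(1) m(2), of z] by simp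
  then show ?thesis
    using op_mode_left[OF assms(1) m(2)[of w], of z k] by simp
qed

lemma op_modes_leibniz:
  assumes "p \<in> L" "q \<in> L"
  shows "\<i> * of_real k * op (mode p z) (mode q w) k =
    op (mode p (\<i> * of_real p * z)) (mode q w) k + op (mode p z) (mode q (\<i> * of_real q * w)) k"
proof -
  have m: "mode p z \<in> A" "mode q z \<in> A" for z using assms by (simp_all add: mode_in_algA)
  show ?thesis
    using fun_cong[OF op_leibniz[OF m(1)[of z] m(2)[of w]], of k] unfolding dlat_mode
    by (simp add: m) (simp add: dlat_def)
qed

text \<open>The four combinations are the coefficients of \<open>z w\<close>, \<open>z (cnj w)\<close>, \<open>cnj z w\<close>
  and \<open>cnj z (cnj w)\<close> in the real-bilinear map \<open>(z, w) \<mapsto> op (mode p z) (mode q w) k\<close>;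
  the Leibniz rule is diagonal on them.\<close>
lemma op_modes_coefficients:
  assumes pq: "p \<in> L" "q \<in> L"
  defines "a \<equiv> op (mode p 1) (mode q 1)" and "b \<equiv> op (mode p \<i>) (mode q 1)"
    and "c \<equiv> op (mode p 1) (mode q \<i>)" and "d \<equiv> op (mode p \<i>) (mode q \<i>)"
  shows "k \<noteq> p + q \<Longrightarrow> a k - \<i> * b k - \<i> * c k - d k = 0"
    and "k \<noteq> p - q \<Longrightarrow> a k - \<i> * b k + \<i> * c k + d k = 0"
    and "k \<noteq> q - p \<Longrightarrow> a k + \<i> * b k - \<i> * c k + d k = 0"
    and "k \<noteq> - p - q \<Longrightarrow> a k + \<i> * b k + \<i> * c k - d k = 0"
proof -
  have ii: "\<i> * complex_of_real r * \<i> = - of_real r" for r by (simp add: complex_eq_iff)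
  \<comment> \<open>The Leibniz rule at amplitudes \<open>1\<close> and \<open>\<i>\<close> in each
    factor is a linear system for the four values.\<close>
  have e: "\<i> * of_real k * a k = of_real p * b k + of_real q * c k"
    "\<i> * of_real k * b k = - of_real p * a k + of_real q * d k"
    "\<i> * of_real k * c k = of_real p * d k - of_real q * a k"
    "\<i> * of_real k * d k = - of_real p * c k - of_real q * b k"
    using op_modes_leibniz[OF pq, of k 1 1] op_modes_leibniz[OF pq, of k \<i> 1, unfolded ii]
      op_modes_leibniz[OF pq, of k 1 \<i>, unfolded ii] op_modes_leibniz[OF pq, of k \<i> \<i>, unfolded ii]
      op_modes[OF pq, of "\<i> * of_real p" 1 k] op_modes[OF pq, of 1 "\<i> * of_real q" k]
      op_modes[OF pq, of "- of_real p" 1 k] op_modes[OF pq, of \<i> "\<i> * of_real q" k]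
      op_modes[OF pq, of "\<i> * of_real p" \<i> k] op_modes[OF pq, of 1 "- of_real q" k]
      op_modes[OF pq, of "- of_real p" \<i> k] op_modes[OF pq, of \<i> "- of_real q" k]
    unfolding a_def b_def c_def d_def by simp_all
  have i: "\<i> * \<i> = -1" by simp
  have cancel: "x = 0" if "(of_real r - of_real s) * x = (0::complex)" "r \<noteq> s" for r s :: real and x
    using that by auto
  have "(of_real k - of_real (p + q)) * (a k - \<i> * b k - \<i> * c k - d k) = 0"
    using e i unfolding of_real_add by algebra
  then show "k \<noteq> p + q \<Longrightarrow> a k - \<i> * b k - \<i> * c k - d k = 0" by (rule cancel)
  have "(of_real k - of_real (p - q)) * (a k - \<i> * b k + \<i> * c k + d k) = 0"
    using e i unfolding of_real_diff by algebra
  then show "k \<noteq> p - q \<Longrightarrow> a k - \<i> * b k + \<i> * c k + d k = 0" by (rule cancel)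
  have "(of_real k - of_real (q - p)) * (a k + \<i> * b k - \<i> * c k + d k) = 0"
    using e i unfolding of_real_diff by algebra
  then show "k \<noteq> q - p \<Longrightarrow> a k + \<i> * b k - \<i> * c k + d k = 0" by (rule cancel)
  have "(of_real k - of_real (- p - q)) * (a k + \<i> * b k + \<i> * c k - d k) = 0"
    using e i unfolding of_real_diff of_real_minus by algebra
  then show "k \<noteq> - p - q \<Longrightarrow> a k + \<i> * b k + \<i> * c k - d k = 0" by (rule cancel)
qed

definition triad_coeff :: "real \<Rightarrow> real \<Rightarrow> complex" where
  "triad_coeff p q = op (mode p 1) (mode q 1) (p + q)"

text \<open>The frequency \<open>p + q\<close> differs from the other three signed sums since
  \<open>p\<close>, \<open>q\<close> and \<open>p + q\<close> are nonzero, so only the coefficient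
  of \<open>z * w\<close> survives.\<close>

lemma op_modes_resonant:
  assumes pq: "p \<in> L" "q \<in> L" and "p + q \<noteq> 0"
  shows "op (mode p z) (mode q w) (p + q) = triad_coeff p q * z * w"
proof -
  define a b c d where "a = op (mode p 1) (mode q 1) (p + q)" and "b = op (mode p \<i>) (mode q 1) (p + q)"
    and "c = op (mode p 1) (mode q \<i>) (p + q)" and "d = op (mode p \<i>) (mode q \<i>) (p + q)"
  note nz = lattice_nonzero[OF pq(1)] lattice_nonzero[OF pq(2)]
  have "a - \<i> * b + \<i> * c + d = 0" "a + \<i> * b - \<i> * c + d = 0" "a + \<i> * b + \<i> * c - d = 0"
    unfolding a_def b_def c_def d_def
    by (rule op_modes_coefficients[OF pq]; use nz assms(3) in simp)+
  moreover have "\<i> * \<i> = -1" by simp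
  ultimately have bcd: "2 * b = 2 * \<i> * a" "2 * c = 2 * \<i> * a" "2 * d = - 2 * a" by algebra+
  then have "b = \<i> * a" "c = \<i> * a" "d = - a" by simp_all
  then have "op (mode p z) (mode q w) (p + q) = a * (Re z + \<i> * Im z) * (Re w + \<i> * Im w)"
    using op_modes[OF pq, of z w "p + q"] unfolding a_def[symmetric] b_def[symmetric] c_def[symmetric] d_def[symmetric]
    by (simp add: algebra_simps)
  then show ?thesis by (simp add: complex_eq[symmetric] a_def triad_coeff_def)
qed

text \<open>Off the four signed sums all four coefficients vanish, and with them the values at the
  amplitudes \<open>1\<close> and \<open>\<i>\<close>.\<close>

lemma op_modes_nonresonant:
  assumes pq: "p \<in> L" "q \<in> L" and k: "k \<noteq> p + q" "k \<noteq> p - q" "k \<noteq> q - p" "k \<noteq> - p - q"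
  shows "op (mode p z) (mode q w) k = 0"
proof -
  define a b c d where "a = op (mode p 1) (mode q 1) k" and "b = op (mode p \<i>) (mode q 1) k"
    and "c = op (mode p 1) (mode q \<i>) k" and "d = op (mode p \<i>) (mode q \<i>) k"
  have "a - \<i> * b - \<i> * c - d = 0" "a - \<i> * b + \<i> * c + d = 0"
    "a + \<i> * b - \<i> * c + d = 0" "a + \<i> * b + \<i> * c - d = 0"
    unfolding a_def b_def c_def d_def
    by (rule op_modes_coefficients(1)[OF pq k(1)] op_modes_coefficients(2)[OF pq k(2)]
        op_modes_coefficients(3)[OF pq k(3)] op_modes_coefficients(4)[OF pq k(4)])+
  moreover have "\<i> * \<i> = -1" by simp
  ultimately have "4 * a = 0" "4 * b = 0" "4 * c = 0" "4 * d = 0" by algebra+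
  then show ?thesis using op_modes[OF pq, of z w k] unfolding a_def b_def c_def d_def by simp
qed

lemma triad_coeff_commute:
  "p \<in> L \<Longrightarrow> q \<in> L \<Longrightarrow> triad_coeff p q = triad_coeff q p"
  using op_commute[OF mode_in_algA mode_in_algA, of p q 1 1] by (simp add: triad_coeff_def add.commute)

text \<open>A mode of amplitude 1 is even, so parity makes the product of two such modes even; by
  the reality condition its values are then real.\<close>

lemma triad_coeff_uminus:
  assumes "p \<in> L" "q \<in> L"
  shows "cnj (triad_coeff p q) = triad_coeff p q" "triad_coeff (- p) (- q) = triad_coeff p q"
proof -
  have m: "mode p 1 \<in> A" "mode q 1 \<in> A" using assms by (simp_all add: mode_in_algA)
  note nz = assms[THEN lattice_nonzero]
  have "op (mode p 1) (mode q 1) (- (p + q)) = op (mode p 1) (mode q 1) (p + q)"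
    using fun_cong[OF op_parity[OF m], of "p + q"] nz by (simp add: mode_comp_uminus)
  then show "cnj (triad_coeff p q) = triad_coeff p q" "triad_coeff (- p) (- q) = triad_coeff p q"
    using algA_uminus[OF op_closed[OF m], of "p + q"] nz
    by (simp_all add: triad_coeff_def mode_uminus)
qed

lemma triad_coeff_dil:
  assumes "p \<in> L" "q \<in> L"
  shows "triad_coeff (p / lam) (q / lam) = triad_coeff p q"
proof -
  have m: "mode p 1 \<in> A" "mode q 1 \<in> A" using assms by (simp_all add: mode_in_algA)
  show ?thesis
    using fun_cong[OF op_dil[OF m], of "(p + q) / lam"] lam_pos
    unfolding dil_mode unfolding dil_def triad_coeff_def add_divide_distrib[symmetric] by simp
qed

text \<open>The scaling axiom supplies one factor \<open>lam\<close>. Iteration gives natural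
  powers, undoing a natural power gives the negative ones, and the sign comes from
  \<open>triad_coeff_uminus\<close>.\<close>

lemma triad_coeff_scale:
  assumes pq: "p \<in> L" "q \<in> L" and k: "k \<in> L"
  shows "triad_coeff (p / k) (q / k) = triad_coeff p q"
proof -
  have nat: "triad_coeff (p / lam ^ n) (q / lam ^ n) = triad_coeff p q" if "p \<in> L" "q \<in> L" for p q n
  proof (induction n)
    case (Suc n)
    have "triad_coeff (p / lam ^ n / lam) (q / lam ^ n / lam) = triad_coeff (p / lam ^ n) (q / lam ^ n)"
      using that by (intro triad_coeff_dil lattice_divide power_in_lattice)
    then show ?case using Suc by (simp add: mult.commute)
  qed simp
  have powi: "triad_coeff (p / lam powi n) (q / lam powi n) = triad_coeff p q" if "p \<in> L" "q \<in> L" for p q n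
  proof (cases n rule: int_cases2)
    case (nonneg m)
    then show ?thesis using nat[OF that] by simp
  next
    case (nonpos m)
    have "triad_coeff (p * lam ^ m / lam ^ m) (q * lam ^ m / lam ^ m) = triad_coeff (p * lam ^ m) (q * lam ^ m)"
      using that by (intro nat lattice_mult power_in_lattice)
    moreover have "x * lam ^ m / lam ^ m = x" "x / lam powi n = x * lam ^ m" for x
      using nonpos lam_pos by (simp_all add: power_int_minus divide_inverse)
    ultimately show ?thesis by (simp only:)
  qed
  from k show ?thesis
  proof (cases rule: lattice_E)
    case (1 n)
    then show ?thesis using powi[OF pq] by simp
  next
    case (2 n)
    then show ?thesis
      using powi[of "- p" "- q" n] pq triad_coeff_uminus[OF pq] by simp
  qed
qed

text \<open>Averaged associativity for the modes \<open>p\<close>, \<open>q\<close>,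
  \<open>1\<close> compares the product of the first two at frequency 1 with that of the last two at
  frequency \<open>p = - q + 1\<close>. It compares real parts, which suffices as the coefficients
  are real; dividing by \<open>p\<close> then restores a triad.\<close>

lemma triad_coeff_rotate:
  assumes "(p, q) \<in> triads lam"
  shows "triad_coeff (- q / p) (1 / p) = triad_coeff p q"
proof -
  note D = triads_D(1-4)[OF assms]
  have sum: "p + q = 1" "- q + 1 = p" using triads_sum[OF assms] by simp_all
  have m: "mode p 1 \<in> A" "mode q 1 \<in> A" "mode 1 1 \<in> A" using D by (simp_all add: mode_in_algA lattice_1)
  have "op (mode (- q) 1) (mode 1 1) p = triad_coeff (- q) 1"
    unfolding triad_coeff_def sum(2) ..
  then have "op (mode q 1) (mode 1 1) p = triad_coeff (- q) 1"
    using mode_uminus[of q 1] D(4) by simp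
  then have "Re (triad_coeff p q) = Re (triad_coeff (- q) 1)"
    using op_assoc[OF m] ip_mode(1)[OF op_closed[OF m(1,2)] lattice_1, of 1]
      ip_mode(2)[OF op_closed[OF m(2,3)] D(1), of 1]
    unfolding triad_coeff_def by (simp add: sum)
  moreover have "Im (triad_coeff p q) = 0" "Im (triad_coeff (- q) 1) = 0"
    using triad_coeff_uminus(1)[of p q] triad_coeff_uminus(1)[of "- q" 1] D lattice_1
    by (auto simp: complex_eq_iff)
  ultimately have "triad_coeff p q = triad_coeff (- q) 1" by (simp add: complex_eq_iff)
  then show ?thesis using triad_coeff_scale[of "- q" 1 p] D lattice_1 by simp
qed

section \<open>Products and invariant weights\<close>

lemma invariant_weight_triad_coeff: "invariant_weight lam (\<lambda>(p, q). Re (triad_coeff p q))"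
  unfolding invariant_weight_def
proof (intro allI impI)
  fix p q assume pq: "(p, q) \<in> triads lam"
  have "triad_coeff (1 / p) (- q / p) = triad_coeff p q"
    using triad_coeff_rotate[OF pq] triad_coeff_commute[of "1 / p" "- q / p"] triads_D(1,2)[OF triads_inverse[OF pq]]
    by simp
  moreover have "triad_coeff q p = triad_coeff p q"
    using triad_coeff_commute triads_D(1,2)[OF pq] by simp
  ultimately show "(case (q, p) of (p, q) \<Rightarrow> Re (triad_coeff p q)) = (case (p, q) of (p, q) \<Rightarrow> Re (triad_coeff p q)) \<and>
    (case (1 / p, - q / p) of (p, q) \<Rightarrow> Re (triad_coeff p q)) = (case (p, q) of (p, q) \<Rightarrow> Re (triad_coeff p q))"
    by simp
qed

end

text \<open>On two modes a product is supported on the four signed sums of the frequencies. Negating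
  a frequency conjugates its amplitude, which reduces all four to \<open>p + q\<close>, and scaling
  by \<open>p + q\<close> reduces the coefficient to that of a triad.\<close>

lemma symmetric_product_eqI_triad_coeff:
  assumes op: "symmetric_product lam op" and op': "symmetric_product lam op'"
    and coeff: "\<And>p q. (p, q) \<in> triads lam \<Longrightarrow> triad_coeff op p q = triad_coeff op' p q"
    and fg: "f \<in> A" "g \<in> A"
  shows "op f g = op' f g"
proof (rule symmetric_product_eqI[OF op op' _ fg])
  have coeff': "triad_coeff op p q = triad_coeff op' p q" if "p \<in> L" "q \<in> L" "p + q \<in> L" for p q
  proof -
    have "(p / (p + q), q / (p + q)) \<in> triads lam"
      using that lattice_nonzero[of "p + q"] by (simp add: triads_def lattice_divide add_divide_distrib[symmetric])
    from coeff[OF this] show ?thesis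
      using triad_coeff_scale[OF op that] triad_coeff_scale[OF op' that] by simp
  qed
  have res: "op (mode p z) (mode q w) (p + q) = op' (mode p z) (mode q w) (p + q)"
    if pq: "p \<in> L" "q \<in> L" for p q z w
  proof (cases "p + q \<in> L")
    case True
    then show ?thesis
      using op_modes_resonant[OF op pq] op_modes_resonant[OF op' pq] coeff'[OF pq] lattice_nonzero by simp
  next
    case False
    then show ?thesis
      using pq algA_outside[OF op_closed[OF op]] algA_outside[OF op_closed[OF op']] mode_in_algA by simp
  qed
  fix p q z w assume pq: "p \<in> L" "q \<in> L"
  note nz = pq[THEN lattice_nonzero]
  show "op (mode p z) (mode q w) = op' (mode p z) (mode q w)"
  proof
    fix k
    consider "k = p + q" | "k = p - q" | "k = - p + q" | "k = - p - q" |
      "k \<noteq> p + q" "k \<noteq> p - q" "k \<noteq> q - p" "k \<noteq> - p - q" by force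
    then show "op (mode p z) (mode q w) k = op' (mode p z) (mode q w) k"
    proof cases
      case 1 then show ?thesis using res[of p q z w] pq by simp
    next
      case 2 then show ?thesis using res[of p "- q" z "cnj w"] pq nz by (simp add: mode_uminus)
    next
      case 3 then show ?thesis using res[of "- p" q "cnj z" w] pq nz by (simp add: mode_uminus)
    next
      case 4 then show ?thesis using res[of "- p" "- q" "cnj z" "cnj w"] pq nz by (simp add: mode_uminus)
    next
      case 5 then show ?thesis using op_modes_nonresonant[OF op pq] op_modes_nonresonant[OF op' pq] by simp
    qed
  qed
qed

text \<open>Among the triads only \<open>(p, q)\<close> itself has components equal to
  \<open>p\<close> and \<open>q\<close> up to sign, so a single term of the sum survives.\<close>

lemma triad_coeff_triad_op:
  assumes fin: "finite (triads lam)" and w: "invariant_weight lam w" and pq: "(p, q) \<in> triads lam"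
  shows "triad_coeff (triad_op lam w) p q = of_real (w (p, q))"
proof -
  note D = triads_D[OF pq]
  have m: "of_real (w x) * (mode p 1 (fst x) * mode q 1 (snd x)) = (if x = (p, q) then of_real (w (p, q)) else 0)"
    if "x \<in> triads lam" for x
    using triads_sum[of "fst x" "snd x"] that D by (cases x) (auto simp: mode_def)
  have "triad_coeff (triad_op lam w) p q = (\<Sum>x\<in>triads lam. of_real (w x) * (mode p 1 (fst x) * mode q 1 (snd x)))"
    by (simp add: triad_coeff_def[OF symmetric_product_triad_op[OF fin w]] triad_op_def triads_sum[OF pq] lattice_1 split_beta)
  also have "\<dots> = (\<Sum>x\<in>triads lam. if x = (p, q) then of_real (w (p, q)) else 0)"
    by (rule sum.cong[OF refl m])
  finally show ?thesis using fin pq by simp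
qed

text \<open>The weight is formed from the coefficients of the product, which are real. The triad sum
  with this weight has the same coefficients and so agrees with the product on the algebra.\<close>

theorem symmetric_product_iff_triad_op:
  assumes fin: "finite (triads lam)"
  shows "symmetric_product lam op \<longleftrightarrow>
    (\<exists>w. invariant_weight lam w \<and> (\<forall>f\<in>A. \<forall>g\<in>A. op f g = triad_op lam w f g))"
proof
  assume op: "symmetric_product lam op"
  define w where "w = (\<lambda>(p, q). Re (triad_coeff op p q))"
  have w: "invariant_weight lam w" unfolding w_def by (rule invariant_weight_triad_coeff[OF op])
  have "triad_coeff op p q = triad_coeff (triad_op lam w) p q" if "(p, q) \<in> triads lam" for p q
    using triad_coeff_uminus(1)[OF op triads_D(1,2)[OF that]] triad_coeff_triad_op[OF fin w that]
    by (auto simp: complex_eq_iff w_def)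
  then show "\<exists>w. invariant_weight lam w \<and> (\<forall>f\<in>A. \<forall>g\<in>A. op f g = triad_op lam w f g)"
    using symmetric_product_eqI_triad_coeff[OF op symmetric_product_triad_op[OF fin w]] w by blast
next
  assume "\<exists>w. invariant_weight lam w \<and> (\<forall>f\<in>A. \<forall>g\<in>A. op f g = triad_op lam w f g)"
  then obtain w where w: "invariant_weight lam w" "\<And>f g. f \<in> A \<Longrightarrow> g \<in> A \<Longrightarrow> op f g = triad_op lam w f g"
    by blast
  show "symmetric_product lam op"
    by (rule symmetric_product_cong[OF w(2) symmetric_product_triad_op[OF fin w(1)]])
       (simp_all add: algA_linear algA_dil algA_comp_uminus)
qed

end

section \<open>Orbits of triads\<close>

text \<open>These are the six permutations of the triple \<open>(p, q, -1)\<close>, each rescaled to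
  end in -1.\<close>

definition triad_orbit :: "real \<Rightarrow> real \<Rightarrow> (real \<times> real) set" where
  "triad_orbit p q = {(p, q), (q, p), (1 / p, - q / p), (- q / p, 1 / p), (- p / q, 1 / q), (1 / q, - p / q)}"

lemma finite_triad_orbit [simp]: "finite (triad_orbit p q)"
  by (simp add: triad_orbit_def)

lemma triad_orbit_self: "(p, q) \<in> triad_orbit p q"
  by (simp add: triad_orbit_def)

lemma triad_orbit_swap: "(x, y) \<in> triad_orbit p q \<Longrightarrow> (y, x) \<in> triad_orbit p q"
  by (auto simp: triad_orbit_def)

lemma triad_orbit_inverse:
  assumes "p \<noteq> 0" "q \<noteq> 0" "(x, y) \<in> triad_orbit p q"
  shows "(1 / x, - y / x) \<in> triad_orbit p q"
proof -
  have "x = p \<and> y = q \<or> x = q \<and> y = p \<or> x = 1 / p \<and> y = - q / p \<or> x = - q / p \<and> y = 1 / p \<or>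
      x = - p / q \<and> y = 1 / q \<or> x = 1 / q \<and> y = - p / q"
    using assms(3) by (simp add: triad_orbit_def)
  then show ?thesis
    using assms(1,2) by (elim disjE conjE) (simp_all add: triad_orbit_def)
qed

lemma T1_eq_triad_orbit: "s > 0 \<Longrightarrow> T1 s = triad_orbit (s ^ 3) (- s)"
  unfolding T1_def triad_orbit_def
  by (simp add: power_int_minus field_simps power2_eq_square power3_eq_cube insert_commute)

lemma T2_eq_triad_orbit: "s > 0 \<Longrightarrow> T2 s = triad_orbit (s ^ 5) (- (s ^ 4))"
  unfolding T2_def triad_orbit_def
  by (simp add: power_int_minus field_simps insert_commute eval_nat_numeral)

lemma powi_inject: "lam > 1 \<Longrightarrow> lam powi i = lam powi j \<longleftrightarrow> i = (j :: int)" for lam :: real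
  by (metis linorder_neq_iff power_int_strict_increasing)

text \<open>The first components alone already separate the sets, being distinct signed powers of
  \<open>s\<close>; for \<open>s > 1\<close> powers are compared by their exponents.\<close>

lemma T1_T2_disjoint:
  assumes "s > 1"
  shows "T1 s \<inter> T2 s = {}"
proof -
  have pos: "s powi i > 0" for i using assms by simp
  have ne: "s powi i \<noteq> - (s powi j)" "- (s powi j) \<noteq> s powi i" for i j
    using pos[of i] pos[of j] by linarith+
  have "fst x \<in> {s powi 3, - (s powi 1), s powi 2, - (s powi (-1)), s powi (-3), s powi (-2)}"
    if "x \<in> T1 s" for x using that unfolding T1_def by auto
  moreover have "fst x \<in> {s powi 5, - (s powi 4), s powi 1, - (s powi (-4)), s powi (-5), s powi (-1)}"
    if "x \<in> T2 s" for x using that unfolding T2_def by auto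
  moreover have "{s powi 3, - (s powi 1), s powi 2, - (s powi (-1)), s powi (-3), s powi (-2)} \<inter>
    {s powi 5, - (s powi 4), s powi 1, - (s powi (-4)), s powi (-5), s powi (-1)} = {}"
    by (simp only: Int_insert_left Int_empty_left insert_iff empty_iff ne powi_inject[OF assms] neg_equal_iff_equal)
       simp
  ultimately show ?thesis by blast
qed

context log_lattice
begin

lemma triad_orbit_subset:
  assumes pq: "(p, q) \<in> triads lam"
  shows "triad_orbit p q \<subseteq> triads lam"
proof -
  have "(1 / q, - p / q) \<in> triads lam" by (rule triads_inverse[OF triads_swap[OF pq]])
  then show ?thesis
    using pq triads_swap[OF pq] triads_inverse[OF pq] triads_rotate[OF pq] triads_swap
    by (simp add: triad_orbit_def)
qed

lemma invariant_weight_orbit: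
  assumes w: "invariant_weight lam w" and pq: "(p, q) \<in> triads lam" and x: "x \<in> triad_orbit p q"
  shows "w x = w (p, q)"
proof -
  have swap: "w (q, p) = w (p, q)" if "(p, q) \<in> triads lam" for p q
    using w that unfolding invariant_weight_def by blast
  have inv: "w (1 / p, - q / p) = w (p, q)" if "(p, q) \<in> triads lam" for p q
    using w that unfolding invariant_weight_def by blast
  note qp = triads_swap[OF pq]
  have "w (- q / p, 1 / p) = w (p, q)" "w (1 / q, - p / q) = w (p, q)" "w (- p / q, 1 / q) = w (p, q)"
    using swap[OF pq] inv[OF pq] inv[OF qp] swap[OF triads_inverse[OF pq]] swap[OF triads_inverse[OF qp]]
    by simp_all
  then show ?thesis using x swap[OF pq] inv[OF pq] by (auto simp: triad_orbit_def)
qed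

text \<open>If exactly one of \<open>p\<close>, \<open>q\<close> is negative, the equation reads
  \<open>lam powi i = 1 + lam powi j\<close>. Two positive summands are brought to this form by
  inversion, and two negative ones cannot sum to 1.\<close>

lemma triad_representative:
  assumes lam: "lam > 1" and pq: "(p, q) \<in> triads lam"
  obtains m n :: nat where "n < m" "lam ^ m - lam ^ n = 1" "(p, q) \<in> triad_orbit (lam ^ m) (- (lam ^ n))"
proof -
  define R where "R = (\<lambda>x. \<exists>m n :: nat. n < m \<and> lam ^ m - lam ^ n = 1 \<and> x \<in> triad_orbit (lam ^ m) (- (lam ^ n)))"
  have R_swap: "R (q, p)" if "R (p, q)" for p q
    using that triad_orbit_swap unfolding R_def by blast
  have R_inverse: "R (1 / p, - q / p)" if "R (p, q)" for p q
    using that triad_orbit_inverse lam_pos unfolding R_def by (metis neg_equal_0_iff_equal not_less_iff_gr_or_eq zero_less_power)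
  have R_diff: "R (lam powi i, - (lam powi j))" if ij: "lam powi i = 1 + lam powi j" for i j
  proof -
    have pos: "lam powi k > 0" for k using lam by simp
    have "lam powi i > lam powi j" using ij by simp
    then have "i > j" using lam by (metis linorder_not_less power_int_increasing less_imp_le)
    have "lam powi i > lam powi 0" using ij pos[of j] by simp
    then have "i > 0" using lam by (metis linorder_not_less power_int_increasing less_imp_le)
    show ?thesis
    proof (cases "j \<ge> 0")
      case True
      have "lam powi i = lam ^ nat i" "lam powi j = lam ^ nat j"
        using True \<open>i > 0\<close> by (simp_all add: power_int_def)
      moreover have "nat j < nat i" using True \<open>i > j\<close> by simp
      ultimately show ?thesis using ij unfolding R_def
        by (intro exI[of _ "nat i"] exI[of _ "nat j"]) (simp add: triad_orbit_self)
    next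
      \<comment> \<open>For negative \<open>j\<close>, dividing by \<open>lam powi j\<close> makes
        both exponents natural, namely \<open>i - j\<close> and \<open>- j\<close>.\<close>
      case False
      have e: "lam ^ nat (i - j) = lam powi i / lam powi j" "lam ^ nat (- j) = 1 / lam powi j"
        using False \<open>i > 0\<close> lam_pos power_int_of_nat[of lam "nat (i - j)"] power_int_of_nat[of lam "nat (- j)"]
        by (simp_all add: power_int_diff power_int_minus divide_inverse)
      have "nat (- j) < nat (i - j)" using False \<open>i > 0\<close> by simp
      moreover have "lam ^ nat (i - j) - lam ^ nat (- j) = 1"
        unfolding e ij using pos[of j] lam_pos by (simp add: add_divide_distrib)
      moreover have "(lam powi i, - (lam powi j)) \<in> triad_orbit (lam ^ nat (i - j)) (- (lam ^ nat (- j)))"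
        unfolding e using pos[of j] lam_pos by (simp add: triad_orbit_def)
      ultimately show ?thesis unfolding R_def by blast
    qed
  qed
  have "p \<in> L" "q \<in> L" and sum: "p + q = 1" using pq by (simp_all add: triads_def)
  from this(1,2) have "R (p, q)"
  proof (elim lattice_E)
    fix i j assume ij: "p = lam powi i" "q = - (lam powi j)"
    then have "lam powi i = 1 + lam powi j" using sum by linarith
    then show ?thesis using R_diff unfolding ij by blast
  next
    fix i j assume ij: "p = - (lam powi i)" "q = lam powi j"
    then have "lam powi j = 1 + lam powi i" using sum by linarith
    then show ?thesis using R_diff R_swap unfolding ij by blast
  next
    fix i j assume "p = - (lam powi i)" "q = - (lam powi j)"
    moreover have "lam powi i > 0" "lam powi j > 0" using lam by simp_all
    ultimately show ?thesis using sum by linarith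
  next
    fix i j assume ij: "p = lam powi i" "q = lam powi j"
    have e: "lam powi (- i) = 1 / p" "lam powi (j - i) = q / p"
      using ij lam_pos by (simp_all add: power_int_minus power_int_diff divide_inverse)
    have p: "p > 0" using ij lam by simp
    \<comment> \<open>Dividing \<open>p + q = 1\<close> by \<open>p\<close> gives
      \<open>1 / p = 1 + q / p\<close>.\<close>
    have "R (1 / p, - (q / p))"
      using R_diff[of "- i" "j - i"] sum p unfolding e by (simp add: field_simps)
    from R_inverse[OF this] show ?thesis using p by simp
  qed
  then show ?thesis unfolding R_def using that by blast
qed

lemma triads_single_orbit:
  assumes lam: "lam > 1" and ab: "lam ^ b - lam ^ a = 1"
    and unique: "\<And>m n. n < m \<Longrightarrow> lam ^ m - lam ^ n = 1 \<Longrightarrow> m = b \<and> n = a"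
  shows "triads lam = triad_orbit (lam ^ b) (- (lam ^ a))"
proof
  have "(lam ^ b, - (lam ^ a)) \<in> triads lam" using ab by (simp add: triads_def)
  then show "triad_orbit (lam ^ b) (- (lam ^ a)) \<subseteq> triads lam" by (rule triad_orbit_subset)
  show "triads lam \<subseteq> triad_orbit (lam ^ b) (- (lam ^ a))"
    using triad_representative[OF lam] unique by (metis subrelI)
qed

text \<open>An invariant weight is constant on an orbit, and this constant becomes the prefactor
  \<open>c\<close>.\<close>

lemma symmetric_product_single_orbit:
  assumes orbit: "triads lam = triad_orbit p q" and pq: "(p, q) \<in> triads lam"
  shows "symmetric_product lam op \<longleftrightarrow> (\<exists>c::real. \<forall>f\<in>A. \<forall>g\<in>A.
    op f g = (\<lambda>k. if k \<in> L then complex_of_real c * triad_sum lam f g k else 0))"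
proof -
  have fin: "finite (triads lam)" by (simp add: orbit)
  have sum: "triad_op lam w f g = (\<lambda>k. if k \<in> L then complex_of_real c * triad_sum lam f g k else 0)"
    if "\<And>x. x \<in> triads lam \<Longrightarrow> w x = c" for w c f g
  proof -
    have "triad_sum lam f g k = (\<Sum>(p, q)\<in>triads lam. f (p * k) * g (q * k))" for k
      unfolding triad_sum_def triads_def[symmetric] using fin by simp
    moreover have "(\<Sum>(p, q)\<in>triads lam. of_real (w (p, q)) * (f (p * k) * g (q * k))) =
      of_real c * (\<Sum>(p, q)\<in>triads lam. f (p * k) * g (q * k))" for k
      unfolding sum_distrib_left by (rule sum.cong) (auto simp: that)
    ultimately show ?thesis unfolding triad_op_def by presburger
  qed
  show ?thesis unfolding symmetric_product_iff_triad_op[OF fin]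
  proof
    assume "\<exists>w. invariant_weight lam w \<and> (\<forall>f\<in>A. \<forall>g\<in>A. op f g = triad_op lam w f g)"
    then obtain w where w: "invariant_weight lam w" "\<forall>f\<in>A. \<forall>g\<in>A. op f g = triad_op lam w f g" by blast
    have "w x = w (p, q)" if "x \<in> triads lam" for x
      using invariant_weight_orbit[OF w(1) pq] that by (simp add: orbit)
    from sum[OF this] w(2) show "\<exists>c::real. \<forall>f\<in>A. \<forall>g\<in>A.
      op f g = (\<lambda>k. if k \<in> L then complex_of_real c * triad_sum lam f g k else 0)"
      by (intro exI[of _ "w (p, q)"]) simp
  next
    assume "\<exists>c::real. \<forall>f\<in>A. \<forall>g\<in>A. op f g = (\<lambda>k. if k \<in> L then complex_of_real c * triad_sum lam f g k else 0)"
    then obtain c :: real where c: "\<forall>f\<in>A. \<forall>g\<in>A.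
      op f g = (\<lambda>k. if k \<in> L then complex_of_real c * triad_sum lam f g k else 0)" by blast
    have "invariant_weight lam (\<lambda>_. c)" by (simp add: invariant_weight_def)
    then show "\<exists>w. invariant_weight lam w \<and> (\<forall>f\<in>A. \<forall>g\<in>A. op f g = triad_op lam w f g)"
      using c sum[of "\<lambda>_. c" c] by (intro exI[of _ "\<lambda>_. c"]) simp
  qed
qed

text \<open>Disjointness makes the constant values of a weight on the two orbits independent of each
  other.\<close>

lemma symmetric_product_two_orbits:
  assumes triads: "triads lam = triad_orbit p q \<union> triad_orbit r s"
    and disj: "triad_orbit p q \<inter> triad_orbit r s = {}"
  shows "symmetric_product lam op \<longleftrightarrow> (\<exists>c1 c2::real. \<forall>f\<in>A. \<forall>g\<in>A.
    op f g = (\<lambda>k. if k \<in> L then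
      complex_of_real c1 * (\<Sum>(p, q)\<in>triad_orbit p q. f (p * k) * g (q * k))
      + complex_of_real c2 * (\<Sum>(p, q)\<in>triad_orbit r s. f (p * k) * g (q * k)) else 0))"
    (is "_ \<longleftrightarrow> (\<exists>c1 c2. \<forall>f\<in>A. \<forall>g\<in>A. op f g = ?rhs c1 c2 f g)")
proof -
  have fin: "finite (triads lam)" by (simp add: triads)
  have pq: "(p, q) \<in> triads lam" and rs: "(r, s) \<in> triads lam"
    using triad_orbit_self by (auto simp: triads)
  have sum: "triad_op lam w f g = ?rhs c1 c2 f g"
    if "\<And>x. x \<in> triad_orbit p q \<Longrightarrow> w x = c1" "\<And>x. x \<in> triad_orbit r s \<Longrightarrow> w x = c2" for w c1 c2 f g
  proof -
    have "(\<Sum>(p, q)\<in>triads lam. of_real (w (p, q)) * (f (p * k) * g (q * k))) =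
      (\<Sum>(p, q)\<in>triad_orbit p q. of_real c1 * (f (p * k) * g (q * k))) +
      (\<Sum>(p, q)\<in>triad_orbit r s. of_real c2 * (f (p * k) * g (q * k)))" for k
      unfolding triads using disj
      by (subst sum.union_disjoint) (auto intro!: arg_cong2[of _ _ _ _ "(+)"] sum.cong simp: that)
    then have "(\<Sum>(p, q)\<in>triads lam. of_real (w (p, q)) * (f (p * k) * g (q * k))) =
      of_real c1 * (\<Sum>(p, q)\<in>triad_orbit p q. f (p * k) * g (q * k)) +
      of_real c2 * (\<Sum>(p, q)\<in>triad_orbit r s. f (p * k) * g (q * k))" for k
      by (simp add: sum_distrib_left split_beta)
    then show ?thesis unfolding triad_op_def by presburger
  qed
  show ?thesis unfolding symmetric_product_iff_triad_op[OF fin]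
  proof
    assume "\<exists>w. invariant_weight lam w \<and> (\<forall>f\<in>A. \<forall>g\<in>A. op f g = triad_op lam w f g)"
    then obtain w where w: "invariant_weight lam w" "\<forall>f\<in>A. \<forall>g\<in>A. op f g = triad_op lam w f g" by blast
    from sum[OF invariant_weight_orbit[OF w(1) pq] invariant_weight_orbit[OF w(1) rs]] w(2)
    show "\<exists>c1 c2. \<forall>f\<in>A. \<forall>g\<in>A. op f g = ?rhs c1 c2 f g"
      by (intro exI[of _ "w (p, q)"] exI[of _ "w (r, s)"]) simp
  next
    assume "\<exists>c1 c2. \<forall>f\<in>A. \<forall>g\<in>A. op f g = ?rhs c1 c2 f g"
    then obtain c1 c2 where c: "\<forall>f\<in>A. \<forall>g\<in>A. op f g = ?rhs c1 c2 f g" by blast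
    define w where "w = (\<lambda>x. if x \<in> triad_orbit p q then c1 else c2)"
    have w1: "w x = c1" if "x \<in> triad_orbit p q" for x using that by (simp add: w_def)
    have w2: "w x = c2" if "x \<in> triad_orbit r s" for x using that disj by (auto simp: w_def)
    note nz = triads_D(3,4)[OF pq] triads_D(3,4)[OF rs]
    have "invariant_weight lam w"
      unfolding invariant_weight_def triads
    proof (intro allI impI, elim UnE)
      fix x y assume "(x, y) \<in> triad_orbit p q"
      then show "w (y, x) = w (x, y) \<and> w (1 / x, - y / x) = w (x, y)"
        using w1 triad_orbit_swap triad_orbit_inverse nz by metis
    next
      fix x y assume "(x, y) \<in> triad_orbit r s"
      then show "w (y, x) = w (x, y) \<and> w (1 / x, - y / x) = w (x, y)"
        using w2 triad_orbit_swap triad_orbit_inverse nz by metis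
    qed
    moreover have "\<forall>f\<in>A. \<forall>g\<in>A. op f g = triad_op lam w f g"
      using c sum[of w c1 c2, OF w1 w2] by simp
    ultimately show "\<exists>w. invariant_weight lam w \<and> (\<forall>f\<in>A. \<forall>g\<in>A. op f g = triad_op lam w f g)" by blast
  qed
qed

end

section \<open>Solving the exponent equation for each admissible ratio\<close>

lemma plastic_root_gt_1:
  fixes s :: real
  assumes "s ^ 3 - s - 1 = 0"
  shows "s > 1"
proof (rule ccontr)
  assume "\<not> s > 1"
  \<comment> \<open>In this form \<open>\<bar>s\<bar> \<le> 1\<close> forces \<open>s = 0\<close>,
    and \<open>s < -1\<close> makes the left side negative.\<close>
  have eq: "s * (s\<^sup>2 - 1) = 1" using assms by (simp add: power3_eq_cube power2_eq_square algebra_simps)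
  show False
  proof (cases "\<bar>s\<bar> \<le> 1")
    case True
    then have s2: "s\<^sup>2 \<le> 1" by (simp add: abs_square_le_1)
    have "\<bar>s\<bar> * \<bar>s\<^sup>2 - 1\<bar> \<le> 1 * \<bar>s\<^sup>2 - 1\<bar>" using True by (intro mult_right_mono) auto
    then have "1 \<le> \<bar>s\<^sup>2 - 1\<bar>" using eq by (simp add: abs_mult[symmetric])
    then have "s\<^sup>2 = 0" using s2 by (simp add: abs_if split: if_splits)
    then show False using eq by simp
  next
    case False
    then have "s < 0" "s\<^sup>2 > 1" using \<open>\<not> s > 1\<close> by (auto simp: abs_square_le_1 not_le[symmetric])
    then have "s * (s\<^sup>2 - 1) < 0" by (intro mult_neg_pos) auto
    then show False using eq by simp
  qed
qed

text \<open>For positive \<open>n\<close> the number \<open>2 ^ n + 1\<close> is odd, which would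
  force \<open>m = 0\<close>, and then \<open>2 ^ m\<close> is too small.\<close>

lemma power_two_diff_eq_1:
  assumes "(2::real) ^ m - 2 ^ n = 1"
  shows "m = 1 \<and> n = 0"
proof -
  have "real (2 ^ m) = real (2 ^ n + 1)" using assms by simp
  then have nat: "(2::nat) ^ m = 2 ^ n + 1" by (simp only: of_nat_eq_iff)
  have "n = 0"
  proof (rule ccontr)
    assume "n \<noteq> 0"
    then have "odd ((2::nat) ^ m)" unfolding nat by simp
    then have "m = 0" by simp
    then show False using nat by simp
  qed
  moreover from this have "(2::nat) ^ m = 2 ^ 1" using nat by simp
  then have "m = 1" by (simp only: power_inject_exp)
  ultimately show ?thesis by simp
qed

lemma power_diff_eq_1_cases:
  fixes x :: real
  assumes x: "x > 1" and ab: "0 < a" "a < b" "coprime a b" "x ^ b - x ^ a = 1"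
    and mn: "n < m" "x ^ m - x ^ n = 1"
  shows "m = b \<and> n = a \<or> a = 1 \<and> b = 3 \<and> n = 4 \<and> m = 5 \<or> a = 4 \<and> b = 5 \<and> n = 1 \<and> m = 3"
proof -
  \<comment> \<open>The case \<open>n = 0\<close> would mean \<open>x ^ m = 2\<close>.\<close>
  have "n > 0" using trinom_root_power_neq_2[OF ab(1,2,4), of m] mn(2) by (cases n) auto
  then show ?thesis using trinom_common_root[OF ab(1,2) _ mn(1) ab(3) _ ab(4) mn(2)] x by auto
qed

theorem theorem2:
  fixes lam :: real
    and op :: "(real \<Rightarrow> complex) \<Rightarrow> (real \<Rightarrow> complex) \<Rightarrow> (real \<Rightarrow> complex)"
  shows
   "((lam = 2 \<or> (lam > 1 \<and> (\<exists>a b :: nat. coprime a b \<and> a < b \<and> b \<le> 62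
                    \<and> (a, b) \<notin> {(1, 3), (4, 5)} \<and> lam ^ b - lam ^ a = 1))) \<longrightarrow>
       (symmetric_product lam op \<longleftrightarrow>
         (\<exists>c::real. \<forall>f\<in>algA lam. \<forall>g\<in>algA lam.
            op f g = (\<lambda>k. if k \<in> lattice lam then complex_of_real c * triad_sum lam f g k else 0))))
    \<and> (lam ^ 3 - lam - 1 = 0 \<longrightarrow>
       (symmetric_product lam op \<longleftrightarrow>
         (\<exists>c1 c2::real. \<forall>f\<in>algA lam. \<forall>g\<in>algA lam.
            op f g = (\<lambda>k. if k \<in> lattice lam then
                complex_of_real c1 * (\<Sum>(p, q)\<in>T1 lam. f (p * k) * g (q * k))
              + complex_of_real c2 * (\<Sum>(p, q)\<in>T2 lam. f (p * k) * g (q * k))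
              else 0))))"
proof (intro conjI impI)
  assume hyp: "lam = 2 \<or> (lam > 1 \<and> (\<exists>a b :: nat. coprime a b \<and> a < b \<and> b \<le> 62
                    \<and> (a, b) \<notin> {(1, 3), (4, 5)} \<and> lam ^ b - lam ^ a = 1))"
  then have lam: "lam > 1" by auto
  then interpret log_lattice lam by unfold_locales simp
  obtain a b where ab: "lam ^ b - lam ^ a = 1"
    and unique: "\<And>m n. n < m \<Longrightarrow> lam ^ m - lam ^ n = 1 \<Longrightarrow> m = b \<and> n = a"
  proof (cases "lam = 2")
    case True
    then show thesis using that[of 1 0] power_two_diff_eq_1 by simp
  next
    case False
    then obtain a b :: nat where ab: "coprime a b" "a < b" "(a, b) \<notin> {(1, 3), (4, 5)}" "lam ^ b - lam ^ a = 1"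
      using hyp by auto
    \<comment> \<open>For \<open>a = 0\<close> coprimality forces \<open>b = 1\<close>, that is
      \<open>lam = 2\<close>.\<close>
    have "a > 0" using ab False by (cases a) auto
    then show thesis using that[OF ab(4)] power_diff_eq_1_cases[OF lam _ ab(2,1,4)] ab(3) by auto
  qed
  show "symmetric_product lam op \<longleftrightarrow>
         (\<exists>c::real. \<forall>f\<in>algA lam. \<forall>g\<in>algA lam.
            op f g = (\<lambda>k. if k \<in> lattice lam then complex_of_real c * triad_sum lam f g k else 0))"
    by (rule symmetric_product_single_orbit[OF triads_single_orbit[OF lam ab unique]])
       (use ab in \<open>simp_all add: triads_def\<close>)
next
  assume root: "lam ^ 3 - lam - 1 = 0"
  then have lam: "lam > 1" by (rule plastic_root_gt_1)
  then interpret log_lattice lam by unfold_locales simp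
  have eq3: "lam ^ 3 - lam ^ 1 = 1" using root by simp
  \<comment> \<open>The source of the second orbit is the factorization
    \<open>x^5 - x^4 - 1 = (x^3 - x - 1) (x^2 - x + 1)\<close>.\<close>
  have eq5: "lam ^ 5 - lam ^ 4 = 1"
    using root by algebra
  have in3: "(lam ^ 3, - lam) \<in> triads lam" and in5: "(lam ^ 5, - (lam ^ 4)) \<in> triads lam"
    using eq3 eq5 lam_in_lattice by (simp_all add: triads_def)
  note T = T1_eq_triad_orbit[OF lam_pos] T2_eq_triad_orbit[OF lam_pos]
  have "triads lam = triad_orbit (lam ^ 3) (- lam) \<union> triad_orbit (lam ^ 5) (- (lam ^ 4))"
  proof
    show "triad_orbit (lam ^ 3) (- lam) \<union> triad_orbit (lam ^ 5) (- (lam ^ 4)) \<subseteq> triads lam"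
      using triad_orbit_subset in3 in5 by simp
    show "triads lam \<subseteq> triad_orbit (lam ^ 3) (- lam) \<union> triad_orbit (lam ^ 5) (- (lam ^ 4))"
    proof (rule subrelI)
      fix p q assume "(p, q) \<in> triads lam"
      then obtain m n where mn: "n < m" "lam ^ m - lam ^ n = 1" "(p, q) \<in> triad_orbit (lam ^ m) (- (lam ^ n))"
        by (rule triad_representative[OF lam])
      \<comment> \<open>The exponents 1 and 3 are coprime, so the only other solution is the plastic
        coincidence.\<close>
      have "m = 3 \<and> n = 1 \<or> m = 5 \<and> n = 4"
        using power_diff_eq_1_cases[OF lam _ _ _ eq3 mn(1,2)] by auto
      then show "(p, q) \<in> triad_orbit (lam ^ 3) (- lam) \<union> triad_orbit (lam ^ 5) (- (lam ^ 4))"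
        using mn(3) by auto
    qed
  qed
  from symmetric_product_two_orbits[OF this] show "symmetric_product lam op \<longleftrightarrow>
         (\<exists>c1 c2::real. \<forall>f\<in>algA lam. \<forall>g\<in>algA lam.
            op f g = (\<lambda>k. if k \<in> lattice lam then
                complex_of_real c1 * (\<Sum>(p, q)\<in>T1 lam. f (p * k) * g (q * k))
              + complex_of_real c2 * (\<Sum>(p, q)\<in>T2 lam. f (p * k) * g (q * k))
              else 0))"
    using T1_T2_disjoint[OF lam] unfolding T by blast
qed

end
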